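(* Let $\lambda>0$ and $0<\nu\le 2/3$. The solution $u_\nu$ of $\frac{\partial^{\nu}u}{\partial t^{\nu}}=\lambda^2\frac{\partial^2u}{\partial x^2}$, $x\in\mathbb{R}$, $t>0$, $u(x,0)=\delta(x)$, satisfies \[ u_\nu(x,t)=\frac{3}{2\pi\sqrt t}\int_0^{+\infty}\!\!\int_0^{+\infty}s\,e^{-(s^3+v^3)/(3\sqrt{3t})}\,u_{3\nu}(x,sv)\,ds\,dv, \] where $u_{3\nu}(x,z)$ is the solution of $\frac{\partial^{3\nu}u}{\partial z^{3\nu}}=\lambda^2\frac{\partial^2u}{\partial x^2}$, $x\in\mathbb{R}$, $z>0$, with $u(x,0)=\delta(x)$ if $0<\nu\le\frac13$, and with $u(x,0)=\delta(x)$, $u_z(x,0)=0$ if $\frac13<\nu\le\frac23$.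
   Context: Fractional derivatives are in the Dzherbashyan–Caputo sense: for $m-1<\mu<m$, $\frac{\partial^{\mu}u}{\partial t^{\mu}}(x,t)=\frac{1}{\Gamma(m-\mu)}\int_0^t (t-s)^{m-\mu-1}\frac{\partial^m u}{\partial s^m}(x,s)\,ds$; for $\mu=m$ the ordinary derivative. For $0<\mu\le2$ the solution with these initial conditions is $u_\mu(x,t)=\frac{1}{2\lambda t^{\mu/2}}\sum_{k\ge0}\frac{(-|x|/(\lambda t^{\mu/2}))^k}{k!\,\Gamma(-\mu k/2+1-\mu/2)}$.
   Formalization: At ν=2/3 the series for u_2 vanishes identically, while the solution of the wave equation is the distribution (δ(x−λz)+δ(x+λz))/2; there the identity is stated weakly, tested against continuous compactly supported functions. For ν<2/3 it is pointwise, with u_μ given by the series. *)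

theory Defs
  imports "HOL-Analysis.Analysis"
begin

text \<open>The solution of the time-fractional equation of order mu (0 < mu < 2) with
  diffusion coefficient lambda^2, given by the explicit series of the context.
  1/Gamma is rGamma (which is 0 at the poles of Gamma).\<close>
definition u_sol :: "real \<Rightarrow> real \<Rightarrow> real \<Rightarrow> real \<Rightarrow> real" where
  "u_sol lam mu x t =
     1 / (2 * lam * t powr (mu / 2)) *
     (\<Sum>k. (- \<bar>x\<bar> / (lam * t powr (mu / 2))) ^ k / fact k
            * rGamma (- mu * real k / 2 + 1 - mu / 2))"

definition kern :: "real \<Rightarrow> real \<Rightarrow> real \<Rightarrow> real" where
  "kern t s v = 3 / (2 * pi * sqrt t) * s * exp (- (s ^ 3 + v ^ 3) / (3 * sqrt (3 * t)))"

end

theory Submission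
  imports Defs "HOL-Probability.Probability" "HOL-Real_Asymp.Real_Asymp"
begin

text \<open>
  Up to scaling, \<open>u_sol\<close> with parameter \<open>mu\<close> is the M-Wright function of order \<open>b = mu/2\<close>. Collapsing
  Hankel's contour to two rays at angles \<open>\<plusminus>\<theta>\<close> with \<open>\<pi>/2 < \<theta> < \<pi>/(2 b)\<close> represents it by an absolutely
  convergent integral, whose Mellin transform on the strip \<open>0 < Re \<sigma> < 1\<close> is \<open>\<Gamma>(\<sigma>) / \<Gamma>(1 - b (1 - \<sigma>))\<close>.
  Integrating \<open>z powr (-q)\<close> at \<open>z = s v\<close> against the kernel produces \<open>\<Gamma>((1-q)/3) \<Gamma>((2-q)/3)\<close>, which the triplication
  formula turns into \<open>\<Gamma>(1 - q) / \<Gamma>(1 - q/3)\<close>. So in the variable \<open>x\<close> the Mellin transforms of both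
  sides agree on the line \<open>Re \<sigma> = 1/2\<close>, and Fourier uniqueness gives the identity.
  Termwise integration of the defining series is not possible: its terms are increasingly negative
  powers of \<open>s v\<close>. In the limiting case \<open>nu = 2/3\<close> the same comparison identifies the density of
  \<open>s v\<close> under the kernel with the M-Wright function of order \<open>1/3\<close>.
\<close>

section \<open>Integration on the positive half-line\<close>

text \<open>No contour is ever moved. The ray integral is written down directly, the exponential
  containing \<open>u\<close> is expanded, and Euler integrals with complex rate reproduce the
  series term by term; hence Euler's integral is first needed for every rate in the open right
  half-plane. The Mellin transform is taken in the space variable because there the kernel acts as a
  multiplier: with q = b (1 - \<sigma>), passing from q to q/3 is the same as passing from the order
  b to b/3. All decay estimates used for uniqueness have the form y powr (-1/2), matching the line
  Re \<sigma> = 1/2. The point x = 0 is outside the reach of that transform and becomes a separate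
  moment identity. The case nu = 2/3 differs in kind: at order 2 the coefficients of the series are
  values of 1/Gamma at nonpositive integers, so the series vanishes, whereas the solution consists
  of two masses 1/2 at the points lam z and - lam z. The identity is therefore stated against
  continuous functions of compact support.\<close>

lemma set_integrable_transfer:
  assumes "set_integrable M A f" and "\<And>x. x \<in> A \<Longrightarrow> f x = g x"
  shows "set_integrable M A g"
  using assms set_integrable_cong[OF refl refl, of A f g] by blast

lemma set_integrable_complex_of_real_iff:
  "set_integrable M A (\<lambda>x. complex_of_real (f x)) \<longleftrightarrow> set_integrable M A f"
proof -
  have "(\<lambda>x. indicator A x *\<^sub>R complex_of_real (f x)) = (\<lambda>x. complex_of_real (indicator A x *\<^sub>R f x))"
    by (simp add: scaleR_conv_of_real)
  thus ?thesis unfolding set_integrable_def by (simp only: complex_of_real_integrable_eq)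
qed

lemma set_borel_measurable_lborel:
  fixes f :: "real \<Rightarrow> 'b::real_normed_vector"
  assumes "S \<in> sets borel" "continuous_on S f"
  shows "set_borel_measurable lborel S f"
  unfolding set_borel_measurable_def
  using borel_measurable_continuous_on_indicator[OF assms] by simp

lemma set_integrable_lborel_iff_absolutely_integrable:
  fixes f :: "real \<Rightarrow> 'b::euclidean_space"
  assumes "S \<in> sets borel" "continuous_on S f"
  shows "set_integrable lborel S f \<longleftrightarrow> f absolutely_integrable_on S"
  unfolding set_integrable_def
  using borel_measurable_continuous_on_indicator[OF assms] by (simp add: integrable_completion)

text \<open>The general theorem speaks of absolute integrability for the completed measure;
  continuity on Borel sets supplies the Borel measurability that carries it over to
  \<open>lborel\<close>.\<close>

lemma lborel_change_of_variables:
  fixes f :: "real \<Rightarrow> 'b::euclidean_space" and g h :: "real \<Rightarrow> real"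
  assumes S: "S \<in> sets borel" and T: "T \<in> sets borel" and img: "g ` S = T"
    and f: "continuous_on T f" and h: "continuous_on S h"
    and deriv: "\<And>x. x \<in> S \<Longrightarrow> (g has_field_derivative h x) (at x)"
    and inj: "inj_on g S"
  shows "set_integrable lborel S (\<lambda>x. \<bar>h x\<bar> *\<^sub>R f (g x)) \<longleftrightarrow> set_integrable lborel T f" (is ?I)
    and "(LBINT x:S. \<bar>h x\<bar> *\<^sub>R f (g x)) = (LBINT x:T. f x)" (is ?E)
proof -
  have "continuous_on S g"
    using deriv by (auto intro!: continuous_at_imp_continuous_on DERIV_isCont)
  hence cont: "continuous_on S (\<lambda>x. \<bar>h x\<bar> *\<^sub>R f (g x))"
    using h img by (auto intro!: continuous_intros continuous_on_compose2[OF f])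
  note iff = set_integrable_lborel_iff_absolutely_integrable[OF S cont]
    set_integrable_lborel_iff_absolutely_integrable[OF T f]
  have cv: "(\<lambda>x. \<bar>h x\<bar> *\<^sub>R f (g x)) absolutely_integrable_on S \<and>
      integral S (\<lambda>x. \<bar>h x\<bar> *\<^sub>R f (g x)) = b \<longleftrightarrow>
      f absolutely_integrable_on g ` S \<and> integral (g ` S) f = b" for b
    using S by (intro has_absolute_integral_change_of_variables_real inj)
       (use deriv in \<open>auto intro: has_field_derivative_at_within\<close>)
  show I: ?I
    using cv img by (auto simp: iff)
  show ?E
  proof (cases "set_integrable lborel T f")
    case True
    with I cv[of "integral T f"] img show ?thesis
      by (simp add: set_borel_integral_eq_integral iff)
  next
    \<comment> \<open>Neither side is integrable here, and both integrals take the default value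
      0.\<close>
    case False
    with I show ?thesis
      by (simp add: set_integrable_def set_lebesgue_integral_def not_integrable_integral_eq)
  qed
qed

lemma lborel_scale_pos:
  fixes f :: "real \<Rightarrow> 'b::euclidean_space"
  assumes f: "continuous_on {0<..} f" and c: "c > 0"
  shows "set_integrable lborel {0<..} (\<lambda>x. c *\<^sub>R f (c * x)) \<longleftrightarrow> set_integrable lborel {0<..} f"
    and "(LBINT x:{0<..}. c *\<^sub>R f (c * x)) = (LBINT x:{0<..}. f x)"
proof -
  have img: "(\<lambda>x. c * x) ` {0<..} = {0<..}"
    using c by (auto intro!: image_eqI[where x = "_ / c"])
  have deriv: "((\<lambda>x. c * x) has_field_derivative c) (at x)" for x
    by (auto intro!: derivative_eq_intros)
  have inj: "inj_on (\<lambda>x. c * x) {0<..}" using c by (auto simp: inj_on_def)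
  have ch: "continuous_on {0<..} (\<lambda>x::real. c)" by simp
  note cv = lborel_change_of_variables[OF _ _ img f ch deriv inj]
  show "set_integrable lborel {0<..} (\<lambda>x. c *\<^sub>R f (c * x)) \<longleftrightarrow> set_integrable lborel {0<..} f"
    using cv(1) c by simp
  show "(LBINT x:{0<..}. c *\<^sub>R f (c * x)) = (LBINT x:{0<..}. f x)"
    using cv(2) c by simp
qed

text \<open>\<open>f\<close> is extended by 0 off the open quadrant, where continuity gives joint
  measurability. The majorant \<open>g\<close> is integrated only in the order \<open>y\<close>,
  then \<open>x\<close>, so it suffices to compute its iterated integral in one convenient
  order.\<close>

lemma set_Fubini_pos:
  fixes f :: "real \<Rightarrow> real \<Rightarrow> 'b::{banach, second_countable_topology}" and g :: "real \<Rightarrow> real \<Rightarrow> real"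
  assumes cont: "continuous_on ({0<..} \<times> {0<..}) (\<lambda>(x, y). f x y)"
    and bound: "\<And>x y. x > 0 \<Longrightarrow> y > 0 \<Longrightarrow> norm (f x y) \<le> g x y"
    and int_g: "\<And>x. x > 0 \<Longrightarrow> set_integrable lborel {0<..} (g x)"
    and int_int_g: "set_integrable lborel {0<..} (\<lambda>x. LBINT y:{0<..}. g x y)"
  shows "(LBINT x:{0<..}. LBINT y:{0<..}. f x y) = (LBINT y:{0<..}. LBINT x:{0<..}. f x y)"
    and "set_integrable lborel {0<..} (\<lambda>y. LBINT x:{0<..}. f x y)"
proof -
  define F where "F = (\<lambda>p. indicator ({0<..} \<times> {0<..}) p *\<^sub>R (\<lambda>(x, y). f x y) p)"
  have F: "F (x, y) = indicator {0<..} x *\<^sub>R (indicator {0<..} y *\<^sub>R f x y)" for x y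
    by (auto simp: F_def indicator_def)
  have F': "F (x, y) = indicator {0<..} y *\<^sub>R (indicator {0<..} x *\<^sub>R f x y)" for x y
    by (auto simp: F_def indicator_def)
  have [measurable]: "F \<in> borel_measurable borel"
    unfolding F_def
    by (intro borel_measurable_continuous_on_indicator cont borel_open open_Times) auto
  hence Fm [measurable]: "F \<in> borel_measurable (lborel \<Otimes>\<^sub>M lborel)"
    by (simp add: borel_prod[symmetric] cong: measurable_cong_sets)
  have int1: "integrable lborel (\<lambda>y. F (x, y))" for x
  proof (cases "x > 0")
    case True
    have "integrable lborel (\<lambda>y. indicator {0<..} y *\<^sub>R g x y)"
      using int_g[OF True] by (simp add: set_integrable_def)
    moreover have "(\<lambda>y. F (x, y)) \<in> borel_measurable lborel" by measurable
    ultimately show ?thesis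
    proof (rule Bochner_Integration.integrable_bound)
      show "AE y in lborel. norm (F (x, y)) \<le> norm (indicator {0<..} y *\<^sub>R g x y)"
        using bound[OF True] by (auto simp: F True indicator_def intro!: AE_I2 order_trans[OF bound])
    qed
  qed (simp add: F)
  have int_F: "integrable (lborel \<Otimes>\<^sub>M lborel) F"
  proof (rule lborel_pair.Fubini_integrable)
    have "integrable lborel (\<lambda>x. indicator {0<..} x *\<^sub>R (LBINT y:{0<..}. g x y))"
      using int_int_g by (simp add: set_integrable_def)
    moreover have "(\<lambda>x. LBINT y. norm (F (x, y))) \<in> borel_measurable lborel" by measurable
    ultimately show "integrable lborel (\<lambda>x. LBINT y. norm (F (x, y)))"
    proof (rule Bochner_Integration.integrable_bound, intro AE_I2)
      fix x :: real
      show "norm (LBINT y. norm (F (x, y))) \<le> norm (indicator {0<..} x *\<^sub>R (LBINT y:{0<..}. g x y))"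
      proof (cases "x > 0")
        case True
        have "(LBINT y. norm (F (x, y))) \<le> (LBINT y. indicator {0<..} y *\<^sub>R g x y)"
        proof (rule integral_mono)
          show "integrable lborel (\<lambda>y. norm (F (x, y)))"
            by (intro integrable_norm int1)
          show "integrable lborel (\<lambda>y. indicator {0<..} y *\<^sub>R g x y)"
            using int_g[OF True] by (simp add: set_integrable_def)
        qed (use bound[OF True] in \<open>auto simp: F True indicator_def\<close>)
        thus ?thesis using True by (simp add: set_lebesgue_integral_def)
      qed (simp add: F)
    qed
  qed (use int1 in auto)
  have eq1: "indicator {0<..} x *\<^sub>R (LBINT y:{0<..}. f x y) = (LBINT y. F (x, y))" for x
    by (cases "x > 0") (simp_all add: F set_lebesgue_integral_def)
  have eq2: "indicator {0<..} y *\<^sub>R (LBINT x:{0<..}. f x y) = (LBINT x. F (x, y))" for y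
    by (cases "y > 0") (simp_all add: F' set_lebesgue_integral_def)
  show "(LBINT x:{0<..}. LBINT y:{0<..}. f x y) = (LBINT y:{0<..}. LBINT x:{0<..}. f x y)"
    unfolding set_lebesgue_integral_def[of lborel "{0<..}" "\<lambda>x. LBINT y:{0<..}. f x y"]
      set_lebesgue_integral_def[of lborel "{0<..}" "\<lambda>y. LBINT x:{0<..}. f x y"] eq1 eq2
    using lborel_pair.Fubini_integral[of "\<lambda>x y. F (x, y)"] int_F by simp
  show "set_integrable lborel {0<..} (\<lambda>y. LBINT x:{0<..}. f x y)"
    unfolding set_integrable_def eq2 using lborel_pair.integrable_snd[of "\<lambda>x y. F (x, y)"] int_F by simp
qed

text \<open>Dominated convergence along sequences. The majorant \<open>w\<close> has to be uniform
  over \<open>S\<close>, so bounds that blow up in the parameter call for a smaller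
  \<open>S\<close>.\<close>

lemma continuous_on_LBINT_pos:
  fixes f :: "real \<Rightarrow> real \<Rightarrow> 'b::{banach, second_countable_topology}"
  assumes cont: "\<And>x. x \<in> S \<Longrightarrow> continuous_on {0<..} (f x)"
    and cont': "\<And>r. r > 0 \<Longrightarrow> continuous_on S (\<lambda>x. f x r)"
    and bound: "\<And>x r. x \<in> S \<Longrightarrow> r > 0 \<Longrightarrow> norm (f x r) \<le> w r"
    and w: "set_integrable lborel {0<..} w"
  shows "continuous_on S (\<lambda>x. LBINT r:{0<..}. f x r)"
  unfolding continuous_on_sequentially o_def
proof safe
  fix X a assume X: "\<forall>n. X n \<in> S" and a: "a \<in> S" and lim: "X \<longlonglongrightarrow> a"
  show "(\<lambda>n. LBINT r:{0<..}. f (X n) r) \<longlonglongrightarrow> (LBINT r:{0<..}. f a r)"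
    unfolding set_lebesgue_integral_def
  proof (rule integral_dominated_convergence)
    show "(\<lambda>r. indicator {0<..} r *\<^sub>R f a r) \<in> borel_measurable lborel"
      using set_borel_measurable_lborel[OF _ cont[OF a]] by (simp add: set_borel_measurable_def)
    show "(\<lambda>r. indicator {0<..} r *\<^sub>R f (X n) r) \<in> borel_measurable lborel" for n
      using set_borel_measurable_lborel[OF _ cont] X by (simp add: set_borel_measurable_def)
    show "integrable lborel (\<lambda>r. indicator {0<..} r *\<^sub>R w r)"
      using w by (simp add: set_integrable_def)
    show "AE r in lborel. (\<lambda>n. indicator {0<..} r *\<^sub>R f (X n) r) \<longlonglongrightarrow> indicator {0<..} r *\<^sub>R f a r"
    proof (intro AE_I2)
      fix r :: real
      show "(\<lambda>n. indicator {0<..} r *\<^sub>R f (X n) r) \<longlonglongrightarrow> indicator {0<..} r *\<^sub>R f a r"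
      proof (cases "r > 0")
        case True
        have "(\<lambda>n. f (X n) r) \<longlonglongrightarrow> f a r"
          using cont'[OF True] X a lim unfolding continuous_on_sequentially o_def by blast
        thus ?thesis by (intro tendsto_intros)
      qed simp
    qed
    show "AE r in lborel. norm (indicator {0<..} r *\<^sub>R f (X n) r) \<le> indicator {0<..} r *\<^sub>R w r" for n
      using X bound by (auto simp: indicator_def)
  qed
qed

section \<open>Gamma integrals and triplication\<close>

lemma Gamma_mult_rGamma:
  assumes "Re z > 0"
  shows "Gamma z * rGamma z = 1"
proof -
  have "z \<notin> \<int>\<^sub>\<le>\<^sub>0" using assms by (auto elim!: nonpos_Ints_cases)
  thus ?thesis by (simp add: rGamma_inverse_Gamma Gamma_eq_zero_iff)
qed

text \<open>A positive real factor leaves the argument unchanged, so the principal logarithms add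
  without a multiple of 2 pi i.\<close>

lemma powr_times_of_real_left:
  assumes "r > 0" "w \<noteq> 0"
  shows "(complex_of_real r * w) powr z = of_real r powr z * w powr z"
  using assms Ln_times_of_real[of r w]
  by (simp add: powr_def Ln_of_real exp_add [symmetric] algebra_simps)

lemma Gamma_integral_scaled_of_real:
  assumes z: "Re z > 0" and a: "a > 0"
  shows "set_integrable lborel {0<..} (\<lambda>r. of_real r powr (z - 1) * exp (- (of_real a * of_real r)))"
    and "(LBINT r:{0<..}. of_real r powr (z - 1) * exp (- (of_real a * of_real r)))
           = Gamma z * of_real a powr (- z)"
proof -
  define f where "f = (\<lambda>t. of_real t powr (z - 1) / complex_of_real (exp t))"
  define g where "g = (\<lambda>r. of_real r powr (z - 1) * exp (- (of_real a * complex_of_real r)))"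
  have cont: "continuous_on {0<..} f"
    unfolding f_def by (auto intro!: continuous_intros)
  have int: "set_integrable lborel {0<..} f"
    using absolutely_integrable_Gamma_integral'[OF z]
    unfolding set_integrable_lborel_iff_absolutely_integrable[OF borel_open[OF open_greaterThan] cont] unfolding f_def .
  have val: "(LBINT t:{0<..}. f t) = Gamma z"
    using Gamma_integral_complex'[OF z] unfolding set_borel_integral_eq_integral(2)[OF int]
    by (simp add: f_def integral_unique)
  have eq: "a *\<^sub>R f (a * r) = of_real a powr z * g r" if "r > 0" for r
    using that a powr_times_of_real_left[of a "of_real r" "z - 1"]
    by (simp add: f_def g_def exp_minus exp_of_real [symmetric] scaleR_conv_of_real powr_diff field_simps)
  have nz: "of_real a powr z \<noteq> 0" using a by simp
  have "set_integrable lborel {0<..} (\<lambda>r. a *\<^sub>R f (a * r))"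
    using int lborel_scale_pos(1)[OF cont a] by simp
  hence "set_integrable lborel {0<..} (\<lambda>r. of_real a powr z * g r)"
    by (rule set_integrable_transfer) (simp add: eq)
  thus 1: "set_integrable lborel {0<..} g" using nz by simp
  have "of_real a powr z * (LBINT r:{0<..}. g r) = (LBINT r:{0<..}. of_real a powr z * g r)"
    by simp
  also have "\<dots> = (LBINT r:{0<..}. a *\<^sub>R f (a * r))"
    by (intro set_lebesgue_integral_cong) (auto simp: eq)
  also have "\<dots> = Gamma z"
    using lborel_scale_pos(2)[OF cont a] val by simp
  finally show "(LBINT r:{0<..}. g r) = Gamma z * of_real a powr (- z)"
    using nz by (simp add: powr_minus field_simps)
qed

text \<open>This takes the place of rotating the path in Euler's integral. Writing exp (- \<alpha>
  r) = exp (- A r) exp (\<delta> r) and expanding the last factor leaves only integrals with the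
  real rate \<open>A\<close>, whose values are the terms of a binomial series.\<close>

lemma Gamma_integral_scaled:
  assumes z: "Re z > 0" and \<alpha>: "Re \<alpha> > 0"
  shows "set_integrable lborel {0<..} (\<lambda>r. of_real r powr (z - 1) * exp (- (\<alpha> * of_real r)))"
    and "(LBINT r:{0<..}. of_real r powr (z - 1) * exp (- (\<alpha> * of_real r))) = Gamma z * \<alpha> powr (- z)"
proof -
  \<comment> \<open>The half-plane is exhausted by the discs \<open>\<bar>\<alpha> - A\<bar> < A\<close>, on which the binomial series applies.\<close>
  define A where "A = (cmod \<alpha>)\<^sup>2 / Re \<alpha>"
  define \<delta> where "\<delta> = of_real A - \<alpha>"
  have \<alpha>0: "\<alpha> \<noteq> 0" using \<alpha> by auto
  have A: "A > 0" using \<alpha> \<alpha>0 by (simp add: A_def)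
  \<comment> \<open>With this \<open>A\<close> the right-hand side becomes A^2 -
    |\<alpha>|^2.\<close>
  have "(cmod \<delta>)\<^sup>2 = A\<^sup>2 + (cmod \<alpha>)\<^sup>2 - 2 * (A * Re \<alpha>)"
    unfolding \<delta>_def cmod_power2 by (simp add: power2_eq_square algebra_simps)
  also have "A * Re \<alpha> = (cmod \<alpha>)\<^sup>2" using \<alpha> by (simp add: A_def)
  finally have "(cmod \<delta>)\<^sup>2 < A\<^sup>2" using \<alpha>0 by simp
  hence \<delta>: "cmod \<delta> < A" using A by (simp add: power2_less_imp_less)
  \<comment> \<open>\<open>T\<close> abstracts over both arguments because it serves twice: at
    \<open>z\<close>, \<delta> for the values, and at Re z, |\<delta>| for the integrals of the
    norms, which lie in the same disc.\<close>
  define T where "T = (\<lambda>(z::complex) (\<delta>::complex) n.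
      \<delta> ^ n / fact n * (Gamma (z + of_nat n) * of_real A powr (- (z + of_nat n))))"
  have T: "T z \<delta> sums (Gamma z * (of_real A - \<delta>) powr (- z))" if z: "Re z > 0" and \<delta>: "cmod \<delta> < A" for z \<delta>
  proof -
    have "(\<lambda>n. (- z gchoose n) * (- \<delta> / of_real A) ^ n) sums (1 + (- \<delta> / of_real A)) powr (- z)"
      using \<delta> A by (intro gen_binomial_complex) (simp add: norm_divide)
    hence "(\<lambda>n. Gamma z * of_real A powr (- z) * ((- z gchoose n) * (- \<delta> / of_real A) ^ n)) sums
            (Gamma z * of_real A powr (- z) * (1 + (- \<delta> / of_real A)) powr (- z))"
      by (rule sums_mult)
    also have "(\<lambda>n. Gamma z * of_real A powr (- z) * ((- z gchoose n) * (- \<delta> / of_real A) ^ n)) = T z \<delta>"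
    proof
      fix n
      have nz: "z \<notin> \<int>\<^sub>\<le>\<^sub>0" using z by (auto elim!: nonpos_Ints_cases)
      hence G: "Gamma z \<noteq> 0" by (simp add: Gamma_eq_zero_iff)
      have p: "of_real A powr (- (z + of_nat n)) = of_real A powr (- z) / of_real A ^ n"
        using A by (simp add: powr_diff powr_nat)
      have q: "(- \<delta> / of_real A) ^ n = (-1) ^ n * \<delta> ^ n / of_real A ^ n"
        by (simp only: power_divide power_minus[of \<delta>])
      have "(- z gchoose n) = (-1) ^ n * (Gamma (z + of_nat n) / Gamma z) / fact n"
        using pochhammer_Gamma[OF nz, of n] by (simp add: gbinomial_pochhammer)
      moreover have "Gamma z * P * (s * (g / Gamma z) / F * (s * D / B)) = (s * s) * (D / F * (g * (P / B)))"
        for P s g F D B :: complex using G by simp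
      moreover have "(-1) ^ n * (-1) ^ n = (1 :: complex)" by (simp flip: power_mult_distrib)
      ultimately show "Gamma z * of_real A powr (- z) * ((- z gchoose n) * (- \<delta> / of_real A) ^ n) = T z \<delta> n"
        unfolding T_def p q by simp
    qed
    also have "Gamma z * of_real A powr (- z) * (1 + (- \<delta> / of_real A)) powr (- z)
        = Gamma z * (of_real A - \<delta>) powr (- z)"
    proof -
      have "1 + (- \<delta> / of_real A) \<noteq> 0" using \<delta> A by (auto simp: field_simps)
      moreover have "of_real A * (1 + (- \<delta> / of_real A)) = of_real A - \<delta>"
        using A by (simp add: field_simps)
      ultimately show ?thesis
        using powr_times_of_real_left[OF A, of "1 + (- \<delta> / of_real A)" "- z"] by (simp add: mult.assoc)
    qed
    finally show ?thesis .
  qed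
  define f where "f = (\<lambda>n r. \<delta> ^ n / fact n * (of_real r powr (z + of_nat n - 1) * exp (- (of_real A * complex_of_real r))))"
  have int: "set_integrable lborel {0<..} (f n)" for n
    unfolding f_def using z A by (intro set_integrable_mult_right Gamma_integral_scaled_of_real) auto
  have val: "(LBINT r:{0<..}. f n r) = T z \<delta> n" for n
    unfolding f_def T_def using z A by (subst set_integral_mult_right, subst Gamma_integral_scaled_of_real) auto
  have fsum: "(\<lambda>n. f n r) sums (of_real r powr (z - 1) * exp (- (\<alpha> * of_real r)))"
    and fsumn: "summable (\<lambda>n. norm (f n r))" if "r > 0" for r
  proof -
    have eq: "f n r = of_real r powr (z - 1) * exp (- (of_real A * of_real r)) * ((\<delta> * of_real r) ^ n /\<^sub>R fact n)" for n
    proof -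
      have "of_real r powr (z + of_nat n - 1) = of_real r powr (z - 1) * complex_of_real r ^ n"
        using that by (simp add: powr_add powr_diff powr_nat)
      thus ?thesis by (simp add: f_def power_mult_distrib scaleR_conv_of_real field_simps)
    qed
    have "(\<lambda>n. f n r) sums (of_real r powr (z - 1) * exp (- (of_real A * of_real r)) * exp (\<delta> * of_real r))"
      unfolding eq by (intro sums_mult exp_converges)
    also have "of_real r powr (z - 1) * exp (- (of_real A * of_real r)) * exp (\<delta> * of_real r)
        = of_real r powr (z - 1) * exp (- (\<alpha> * of_real r))"
      by (simp add: \<delta>_def mult.assoc algebra_simps flip: exp_add)
    finally show "(\<lambda>n. f n r) sums (of_real r powr (z - 1) * exp (- (\<alpha> * of_real r)))" .
    show "summable (\<lambda>n. norm (f n r))"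
      unfolding eq norm_mult[of "of_real r powr (z - 1) * exp (- (of_real A * of_real r))"]
      by (intro summable_mult summable_norm_exp)
  qed
  have normf: "(LBINT r:{0<..}. norm (f n r)) = Re (T (of_real (Re z)) (of_real (cmod \<delta>)) n)" for n
  proof -
    have "complex_of_real (LBINT r:{0<..}. norm (f n r)) = (LBINT r:{0<..}. complex_of_real (norm (f n r)))"
      by (simp add: set_integral_complex_of_real)
    also have "\<dots> = (LBINT r:{0<..}. of_real (cmod \<delta>) ^ n / fact n *
        (of_real r powr (of_real (Re z) + of_nat n - 1) * exp (- (of_real A * complex_of_real r))))"
    proof (intro set_lebesgue_integral_cong allI impI)
      fix r :: real assume "r \<in> {0<..}"
      hence r: "r > 0" by simp
      have e: "exp (- (complex_of_real A * complex_of_real r)) = of_real (exp (- (A * r)))"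
        by (simp add: exp_of_real [symmetric])
      have "complex_of_real r powr (of_real (Re z) + of_nat n - 1) = of_real (r powr (Re z + n - 1))"
        using r by (subst powr_of_real[symmetric]) auto
      thus "complex_of_real (norm (f n r)) = of_real (cmod \<delta>) ^ n / fact n *
        (of_real r powr (of_real (Re z) + of_nat n - 1) * exp (- (of_real A * complex_of_real r)))"
        using r unfolding e by (simp add: f_def norm_mult norm_divide norm_power norm_powr_real_powr)
    qed simp
    also have "\<dots> = T (of_real (Re z)) (of_real (cmod \<delta>)) n"
      unfolding T_def using z A by (subst set_integral_mult_right, subst Gamma_integral_scaled_of_real) auto
    finally show ?thesis by (metis Re_complex_of_real)
  qed
  have sumn: "summable (\<lambda>n. LBINT r:{0<..}. norm (f n r))"
    unfolding normf using T[of "of_real (Re z)" "of_real (cmod \<delta>)"] z \<delta>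
    by (intro summable_Re) (auto simp: sums_iff)
  let ?F = "\<lambda>n r. indicator {0<..} r *\<^sub>R f n r"
  have 1: "integrable lborel (?F n)" for n using int by (simp add: set_integrable_def)
  have 2: "AE r in lborel. summable (\<lambda>n. norm (?F n r))"
    using fsumn by (intro AE_I2) (auto simp: indicator_def)
  have 3: "summable (\<lambda>n. LBINT r. norm (?F n r))"
    using sumn by (simp add: set_lebesgue_integral_def)
  have lim: "(\<Sum>n. ?F n r) = indicator {0<..} r *\<^sub>R (of_real r powr (z - 1) * exp (- (\<alpha> * of_real r)))" for r
    using fsum by (auto simp: indicator_def sums_iff)
  show "set_integrable lborel {0<..} (\<lambda>r. of_real r powr (z - 1) * exp (- (\<alpha> * of_real r)))"
    using integrable_suminf[OF 1 2 3] unfolding lim set_integrable_def .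
  have "(LBINT r:{0<..}. of_real r powr (z - 1) * exp (- (\<alpha> * of_real r))) = (\<Sum>n. T z \<delta> n)"
    using integral_suminf[OF 1 2 3] val unfolding lim by (simp add: set_lebesgue_integral_def)
  also have "\<dots> = Gamma z * \<alpha> powr (- z)"
    using T[OF z \<delta>] by (simp add: sums_iff \<delta>_def)
  finally show "(LBINT r:{0<..}. of_real r powr (z - 1) * exp (- (\<alpha> * of_real r))) = Gamma z * \<alpha> powr (- z)" .
qed

lemma Gamma_integral_scaled_real:
  fixes x a :: real
  assumes x: "x > 0" and a: "a > 0"
  shows "set_integrable lborel {0<..} (\<lambda>r. r powr (x - 1) * exp (- (a * r)))"
    and "(LBINT r:{0<..}. r powr (x - 1) * exp (- (a * r))) = Gamma x * a powr (- x)"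
proof -
  have eq: "of_real r powr (of_real x - 1) * exp (- (of_real a * complex_of_real r))
      = of_real (r powr (x - 1) * exp (- (a * r)))" if "r > 0" for r
    using that by (simp add: powr_of_real [symmetric] exp_of_real [symmetric])
  have "set_integrable lborel {0<..} (\<lambda>r. of_real r powr (of_real x - 1) * exp (- (of_real a * complex_of_real r)))"
    using x a by (intro Gamma_integral_scaled(1)) auto
  hence "set_integrable lborel {0<..} (\<lambda>r. complex_of_real (r powr (x - 1) * exp (- (a * r))))"
    by (rule set_integrable_transfer) (simp add: eq)
  thus "set_integrable lborel {0<..} (\<lambda>r. r powr (x - 1) * exp (- (a * r)))"
    by (simp only: set_integrable_complex_of_real_iff)
  have "complex_of_real (LBINT r:{0<..}. r powr (x - 1) * exp (- (a * r)))
      = (LBINT r:{0<..}. of_real r powr (of_real x - 1) * exp (- (of_real a * complex_of_real r)))"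
    unfolding set_integral_complex_of_real [symmetric]
    by (intro set_lebesgue_integral_cong) (auto simp: eq)
  also have "\<dots> = of_real (Gamma x * a powr (- x))"
    using Gamma_integral_scaled(2)[of "of_real x" "of_real a"] x a
    by (simp add: Gamma_complex_of_real powr_of_real [symmetric])
  finally show "(LBINT r:{0<..}. r powr (x - 1) * exp (- (a * r))) = Gamma x * a powr (- x)"
    by (simp only: of_real_eq_iff)
qed

section \<open>Gauss's multiplication formula for three factors\<close>

lemma pochhammer_triple:
  fixes z :: "'a::field_char_0"
  shows "pochhammer (3 * z) (3 * n)
    = 27 ^ n * (pochhammer z n * pochhammer (z + 1/3) n * pochhammer (z + 2/3) n)"
proof (induction n)
  case (Suc n)
  have "3 * Suc n = Suc (Suc (Suc (3 * n)))" by simp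
  hence "pochhammer (3 * z) (3 * Suc n) = pochhammer (3 * z) (3 * n) *
      ((3 * z + of_nat (3 * n)) * (3 * z + of_nat (3 * n) + 1) * (3 * z + of_nat (3 * n) + 2))"
    by (simp only: pochhammer_Suc) (simp add: algebra_simps)
  also have "(3 * z + of_nat (3 * n)) * (3 * z + of_nat (3 * n) + 1) * (3 * z + of_nat (3 * n) + 2)
      = 27 * ((z + of_nat n) * (z + 1/3 + of_nat n) * (z + 2/3 + of_nat n))"
    by (simp add: field_simps)
  finally show ?case
    unfolding Suc.IH by (simp only: pochhammer_Suc power_Suc mult_ac)
qed simp

text \<open>In Gauss's product limit the three series combine into a single one for 3 z, up to a
  factor \<open>C n\<close> free of \<open>z\<close> and an elementary factor \<open>E z n\<close>.
  The limit of \<open>C\<close> is then read off at one point. At the poles both sides are 0 by the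
  convention for \<open>Gamma\<close>.\<close>

theorem Gamma_triplication_complex:
  fixes z :: complex
  shows "Gamma z * Gamma (z + 1/3) * Gamma (z + 2/3)
    = of_real (2 * pi * sqrt 3) * exp (- 3 * z * of_real (ln 3)) * Gamma (3 * z)"
proof -
  define C where "C = (\<lambda>n. fact n ^ 3 * exp (complex_of_real (ln (real n))) * 27 ^ (n + 1) / fact (3 * n + 2))"
  define E where "E = (\<lambda>(z::complex) n. exp (3 * z * of_real (ln (real n) - ln (real (3 * n + 2)))))"
  \<comment> \<open>Three Pochhammer symbols of length n + 1 make up one of length 3 n + 3, which is
    the length in \<open>Gamma_series\<close> at index 3 n + 2.\<close>
  have eq: "Gamma_series z n * Gamma_series (z + 1/3) n * Gamma_series (z + 2/3) n
      = C n * E z n * Gamma_series (3 * z) (3 * n + 2)" for z n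
  proof -
    let ?L = "complex_of_real (ln (real n))" and ?M = "complex_of_real (ln (real (3 * n + 2)))"
    have p: "pochhammer (3 * z) (3 * n + 2 + 1)
        = 27 ^ (n + 1) * (pochhammer z (n + 1) * pochhammer (z + 1/3) (n + 1) * pochhammer (z + 2/3) (n + 1))"
    proof -
      have "3 * n + 2 + 1 = 3 * (n + 1)" by simp
      thus ?thesis by (simp only: pochhammer_triple)
    qed
    have 1: "exp (z * ?L) * exp ((z + 1/3) * ?L) * exp ((z + 2/3) * ?L) = exp (3 * z * ?L) * exp ?L"
      by (simp add: algebra_simps flip: exp_add)
    have 2: "exp (3 * z * ?L) = E z n * exp (3 * z * ?M)"
      by (simp add: E_def algebra_simps flip: exp_add)
    have "Gamma_series z n * Gamma_series (z + 1/3) n * Gamma_series (z + 2/3) n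
        = fact n ^ 3 * (exp (z * ?L) * exp ((z + 1/3) * ?L) * exp ((z + 2/3) * ?L)) /
          (pochhammer z (n + 1) * pochhammer (z + 1/3) (n + 1) * pochhammer (z + 2/3) (n + 1))"
      unfolding Gamma_series_def times_divide_times_eq by (simp only: power3_eq_cube mult_ac)
    also have "\<dots> = C n * E z n * Gamma_series (3 * z) (3 * n + 2)"
    proof -
      have "F * (e * m * x) / w = F * x * c / g * e * (g * m / (c * w))"
        if "c \<noteq> 0" "g \<noteq> 0" for F e m x w c g :: complex
        using that by simp
      from this[of "27 ^ (n + 1)" "fact (3 * n + 2)"] show ?thesis
        unfolding 1 2 C_def Gamma_series_def p by (simp add: mult_ac del: power_Suc fact_Suc pochhammer_Suc)
    qed
    finally show ?thesis .
  qed
  have ln_lim: "(\<lambda>n. ln (real n) - ln (real (3 * n + 2))) \<longlonglongrightarrow> - ln 3"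
    by real_asymp
  have E: "E z \<longlonglongrightarrow> exp (3 * z * of_real (- ln 3))" for z
    unfolding E_def by (intro tendsto_intros ln_lim)
  have G: "(\<lambda>n. Gamma_series (3 * z) (3 * n + 2)) \<longlonglongrightarrow> Gamma (3 * z)" for z :: complex
  proof -
    have "filterlim (\<lambda>n::nat. 3 * n + 2) sequentially sequentially"
      by (intro filterlim_subseq) (auto simp: strict_mono_def)
    from filterlim_compose[OF Gamma_series_LIMSEQ this] show ?thesis .
  qed
  \<comment> \<open>z = 1/3 is chosen because Gamma (3 z) = 1 there and the reflection formula
    evaluates Gamma (1/3) Gamma (2/3); no asymptotics of factorials are involved.\<close>
  define L where "L = Gamma (1/3) * Gamma (1/3 + 1/3) * Gamma (1/3 + 2/3)
      / (exp (3 * (1/3) * complex_of_real (- ln 3)) * Gamma (3 * (1/3)))"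
  have "(\<lambda>n. Gamma_series (1/3) n * Gamma_series (1/3 + 1/3) n * Gamma_series (1/3 + 2/3) n
      / (E (1/3) n * Gamma_series (3 * (1/3)) (3 * n + 2))) \<longlonglongrightarrow> L"
    unfolding L_def by (intro tendsto_intros E G) auto
  also have "(\<lambda>n. Gamma_series (1/3) n * Gamma_series (1/3 + 1/3) n * Gamma_series (1/3 + 2/3) n
      / (E (1/3) n * Gamma_series (3 * (1/3)) (3 * n + 2))) = C"
  proof
    fix n
    have "3 * (1/3) = (1::complex)" by simp
    hence "Gamma_series (3 * (1/3)) (3 * n + 2) \<noteq> (0::complex)"
      by (simp only: Gamma_series_def pochhammer_fact [symmetric])
         (simp only: divide_eq_0_iff mult_eq_0_iff fact_nonzero exp_not_eq_zero simp_thms)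
    moreover have "E (1/3) n \<noteq> 0" by (simp add: E_def)
    ultimately show "Gamma_series (1/3) n * Gamma_series (1/3 + 1/3) n * Gamma_series (1/3 + 2/3) n
      / (E (1/3) n * Gamma_series (3 * (1/3)) (3 * n + 2)) = C n"
      unfolding eq by simp
  qed
  finally have C: "C \<longlonglongrightarrow> L" .
  have "(\<lambda>n. Gamma_series z n * Gamma_series (z + 1/3) n * Gamma_series (z + 2/3) n)
      \<longlonglongrightarrow> Gamma z * Gamma (z + 1/3) * Gamma (z + 2/3)"
    by (intro tendsto_intros)
  moreover have "(\<lambda>n. Gamma_series z n * Gamma_series (z + 1/3) n * Gamma_series (z + 2/3) n)
      \<longlonglongrightarrow> L * exp (3 * z * of_real (- ln 3)) * Gamma (3 * z)"
    unfolding eq by (intro tendsto_intros C E G)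
  ultimately have "Gamma z * Gamma (z + 1/3) * Gamma (z + 2/3) = L * exp (3 * z * of_real (- ln 3)) * Gamma (3 * z)"
    by (rule LIMSEQ_unique)
  also have "L = of_real (2 * pi * sqrt 3)"
  proof -
    have "Gamma (1/3) * Gamma (2/3) = of_real pi / sin (complex_of_real (pi / 3))"
      using Gamma_reflection_complex[of "1/3"] by (simp add: algebra_simps)
    also have "\<dots> = of_real (pi / sin (pi / 3))"
      unfolding sin_of_real by simp
    also have "pi / sin (pi / 3) = 2 * pi * sqrt 3 / 3"
      by (simp add: sin_60 field_simps)
    finally have g: "Gamma (1/3) * Gamma (2/3) = complex_of_real (2 * pi * sqrt 3 / 3)" .
    have "exp (complex_of_real (ln 3)) = 3" by (metis exp_ln exp_of_real of_real_numeral zero_less_numeral)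
    thus ?thesis using g by (simp add: L_def exp_minus field_simps)
  qed
  finally show ?thesis by simp
qed

section \<open>The M-Wright function and its Mellin transform\<close>

text \<open>The usual argument - b k + 1 - b is grouped as 1 - q with q = b (k + 1), the form in
  which the reflection formula will be applied.\<close>

definition mwright :: "real \<Rightarrow> real \<Rightarrow> real" where
  "mwright b u = (\<Sum>k. (- u) ^ k / fact k * rGamma (1 - b * (real k + 1)))"

text \<open>Lets an exponential of U r^b be absorbed by an arbitrarily small part of an exponential
  decay in r.\<close>

lemma powr_less_one_le_linear:
  fixes b c U :: real
  assumes b: "0 < b" "b < 1" and c: "c > 0"
  obtains K where "\<And>r. r > 0 \<Longrightarrow> U * r powr b \<le> c * r + K"
proof (cases "U > 0")
  case False
  have "U * r powr b \<le> c * r + 0" if "r > 0" for r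
  proof -
    have "U * r powr b \<le> 0" using False by (intro mult_nonpos_nonneg) auto
    also have "0 \<le> c * r + 0" using that c by simp
    finally show ?thesis .
  qed
  thus ?thesis by (rule that)
next
  case True
  \<comment> \<open>\<open>s\<close> is where U r^b and c r cross: up to \<open>s\<close> the
    constant U s^b dominates, beyond it the linear term does.\<close>
  define s where "s = (U / c) powr (1 / (1 - b))"
  have s: "s > 0" using True c by (simp add: s_def)
  have Us: "U * s powr (b - 1) = c"
  proof -
    have "1 / (1 - b) * (b - 1) = - 1" using b by (simp add: field_simps)
    hence "s powr (b - 1) = (U / c) powr (- 1)" by (simp only: s_def powr_powr)
    thus ?thesis using True c by (simp add: powr_minus)
  qed
  have "U * r powr b \<le> c * r + U * s powr b" if r: "r > 0" for r
  proof (cases "r \<le> s")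
    case True
    have "U * r powr b \<le> U * s powr b"
      using \<open>U > 0\<close> True r b by (intro mult_left_mono powr_mono2) auto
    thus ?thesis using c r by (simp add: add_increasing)
  next
    case False
    have "r powr b = r * r powr (b - 1)" using r by (simp add: powr_diff)
    moreover have "r powr (b - 1) \<le> s powr (b - 1)"
      using False s b by (intro powr_mono2') auto
    ultimately have "U * r powr b \<le> U * (r * s powr (b - 1))"
      using \<open>U > 0\<close> r by simp
    also have "\<dots> = c * r" using Us by (simp add: algebra_simps)
    also have "\<dots> \<le> c * r + U * s powr b" using \<open>U > 0\<close> by simp
    finally show ?thesis .
  qed
  thus ?thesis by (rule that)
qed

text \<open>Follows from w^\<beta> <= max 1 w <= exp w. It trades exponential decay for a power
  whose exponent can be chosen.\<close>

lemma exp_minus_le_powr: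
  fixes w \<beta> :: real
  assumes "w > 0" "0 \<le> \<beta>" "\<beta> \<le> 1"
  shows "exp (- w) \<le> w powr (- \<beta>)"
proof -
  have "w powr \<beta> \<le> exp w"
  proof (cases "w \<le> 1")
    case True
    have "w powr \<beta> \<le> 1 powr \<beta>" using True assms by (intro powr_mono2) auto
    also have "\<dots> \<le> exp w" using assms by simp
    finally show ?thesis .
  next
    case False
    have "w powr \<beta> \<le> w powr 1" using False assms by (intro powr_mono) auto
    also have "\<dots> \<le> exp w" using assms exp_ge_add_one_self[of w] by (simp del: exp_ge_add_one_self)
    finally show ?thesis .
  qed
  thus ?thesis using assms by (simp add: exp_minus powr_minus)
qed

section \<open>The ray integral for the M-Wright function\<close>

context
  fixes b \<theta> :: real and E B :: complex
  assumes b: "0 < b" "b < 1"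
  defines "\<theta> \<equiv> pi / (1 + b)"
  defines "E \<equiv> cis \<theta>" and "B \<equiv> cis (b * \<theta>)"
begin

text \<open>Hankel's integrand exp (\<zeta> - u \<zeta>^b) \<zeta>^(b-1) d\<zeta> on the ray \<zeta>
  = r E. The factor \<open>E\<close> from d\<zeta> and the phase of \<zeta>^(b-1) combine to
  \<open>B\<close>. The angle is written out so that the constant depends on \<open>b\<close>
  only.\<close>

definition wright_ray :: "real \<Rightarrow> real \<Rightarrow> complex" where
  "wright_ray u r = exp (of_real r * cis (pi / (1 + b))) * cis (b * (pi / (1 + b))) *
     of_real (r powr (b - 1)) * exp (- (of_real (u * r powr b) * cis (b * (pi / (1 + b)))))"

lemma wright_ray_altdef: "wright_ray u r = exp (of_real r * E) * B *
     of_real (r powr (b - 1)) * exp (- (of_real (u * r powr b) * B))"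
  by (simp add: wright_ray_def E_def B_def \<theta>_def)

text \<open>The angle solves \<theta> + b \<theta> = pi, so - E is the conjugate of
  \<open>B\<close>. Thus decay of exp (r E) and decay of exp (- u r^b B) are the same condition b
  \<theta> < pi/2, which is b < 1.\<close>

lemma Re_E_neg: "Re E < 0"
proof -
  have "pi / (1 + b) < pi" "pi / 2 < pi / (1 + b)" using b by (simp_all add: field_simps)
  hence "cos (pi - \<theta>) > 0" unfolding \<theta>_def by (intro cos_gt_zero) auto
  thus ?thesis by (simp add: E_def)
qed

lemma Re_B_pos: "Re B > 0"
proof -
  have "0 < b * \<theta>" "b * \<theta> < pi / 2" using b by (simp_all add: \<theta>_def field_simps)
  thus ?thesis by (simp add: B_def cos_gt_zero)
qed

lemma minus_E_powr: "(- E) powr z = exp (z * (\<i> * of_real (\<theta> - pi)))"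
proof -
  have "- E = cis (\<theta> - pi)" by (simp add: E_def complex_eq_iff cos_diff sin_diff)
  hence "Ln (- E) = \<i> * of_real (\<theta> - pi)"
    using b by (simp add: cis_conv_exp Ln_exp \<theta>_def field_simps)
  moreover have "E \<noteq> 0" by (simp add: E_def)
  ultimately show ?thesis by (simp add: powr_def)
qed

lemma B_powr: "B powr z = exp (z * (\<i> * of_real (b * \<theta>)))"
proof -
  have 1: "0 < b * \<theta>" "b * \<theta> < pi" using b by (simp_all add: \<theta>_def field_simps)
  have "Ln B = \<i> * of_real (b * \<theta>)"
    unfolding B_def cis_conv_exp using 1 by (intro Ln_exp) auto
  moreover have "B \<noteq> 0" by (simp add: B_def)
  ultimately show ?thesis by (simp add: powr_def)
qed

text \<open>The angle \<theta> cancels: the value is independent of the chosen ray, and the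
  remaining phase is the one whose imaginary part is the sine of the reflection formula.\<close>

lemma B_E_powr: "B powr w * (- E) powr (- (of_real b * w)) = exp (\<i> * of_real pi * (of_real b * w))"
  unfolding minus_E_powr B_powr exp_add [symmetric] by (simp add: algebra_simps)

lemma norm_wright_ray:
  "norm (wright_ray u r) = r powr (b - 1) * exp (- (- Re E * r)) * exp (- (u * r powr b * Re B))"
  by (simp add: wright_ray_altdef norm_mult B_def mult.commute)

lemma norm_wright_ray_le:
  assumes "u \<ge> 0"
  shows "norm (wright_ray u r) \<le> r powr (b - 1) * exp (- (- Re E * r))"
proof -
  have "exp (- (u * r powr b * Re B)) \<le> 1" using assms Re_B_pos by simp
  thus ?thesis unfolding norm_wright_ray by (simp add: mult_left_le)
qed

lemma continuous_on_wright_ray: "continuous_on {0<..} (wright_ray u)"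
  unfolding wright_ray_altdef by (auto intro!: continuous_intros)

lemma set_integrable_wright_ray:
  assumes "u \<ge> 0"
  shows "set_integrable lborel {0<..} (wright_ray u)"
proof (rule set_integrable_bound)
  show "set_integrable lborel {0<..} (\<lambda>r. r powr (b - 1) * exp (- (- Re E * r)))"
    using Gamma_integral_scaled_real(1)[of b "- Re E"] b Re_E_neg by simp
qed (use norm_wright_ray_le[OF assms] in
    \<open>auto intro!: AE_I2 set_borel_measurable_lborel continuous_on_wright_ray\<close>)

text \<open>Expanding exp (- u r^b B) and integrating termwise gives Gamma (q k) with phase exp (i
  pi q k), where q k = b (k + 1). Taking the imaginary part stands for adding the conjugate ray, and
  reflection turns Gamma (q k) sin (pi q k) / pi into 1/Gamma (1 - q k). The argument covers every
  real \<open>u\<close>.\<close>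

lemma mwright_sums_ray:
  "(\<lambda>k. (- u) ^ k / fact k * rGamma (1 - b * (real k + 1))) sums (Im (LBINT r:{0<..}. wright_ray u r) / pi)"
proof -
  define f where "f = (\<lambda>k r. exp (of_real r * E) * B * of_real (r powr (b - 1)) *
      ((- (of_real (u * r powr b) * B)) ^ k /\<^sub>R fact k))"
  define q where "q = (\<lambda>k. b * (real k + 1))"
  have q: "q k > 0" for k using b by (simp add: q_def)
  define c where "c = (\<lambda>k. of_real ((- u) ^ k / fact k) * B ^ (k + 1))"
  have eq: "f k r = c k * (of_real r powr (of_real (q k) - 1) * exp (- (- E * of_real r)))"
    if r: "r > 0" for k r
  proof -
    have "r powr (b - 1) * (u * r powr b) ^ k = u ^ k * r powr (q k - 1)"
      using r by (simp add: q_def power_mult_distrib powr_powr powr_realpow' algebra_simps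
          flip: powr_add powr_realpow)
    hence 1: "complex_of_real (r powr (b - 1)) * of_real (u * r powr b) ^ k = of_real u ^ k * of_real (r powr (q k - 1))"
      by (metis of_real_mult of_real_power)
    have 2: "of_real r powr (of_real (q k) - 1) = complex_of_real (r powr (q k - 1))"
      using r by (subst powr_of_real [symmetric]) auto
    have 3: "(- (of_real (u * r powr b) * B)) ^ k = (- 1) ^ k * of_real (u * r powr b) ^ k * B ^ k"
      by (simp only: power_minus[of "_ * B"] power_mult_distrib mult.assoc)
    have 4: "(complex_of_real (- u)) ^ k = (- 1) ^ k * of_real u ^ k"
      by (simp add: power_minus[of "of_real u"])
    have "f k r = exp (of_real r * E) * B * ((complex_of_real (r powr (b - 1)) * of_real (u * r powr b) ^ k) * (- 1) ^ k * B ^ k) / fact k"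
      unfolding f_def 3 by (simp add: scaleR_conv_of_real field_simps)
    also have "\<dots> = c k * (of_real r powr (of_real (q k) - 1) * exp (- (- E * of_real r)))"
      unfolding 1 2 c_def of_real_divide of_real_power 4 by (simp add: field_simps)
    finally show ?thesis .
  qed
  have RE: "Re (- E) > 0" using Re_E_neg by simp
  have int: "set_integrable lborel {0<..} (f k)" for k
  proof -
    have "set_integrable lborel {0<..} (\<lambda>r. c k * (of_real r powr (of_real (q k) - 1) * exp (- (- E * of_real r))))"
      using q RE by (intro set_integrable_mult_right Gamma_integral_scaled(1)) auto
    thus ?thesis by (rule set_integrable_transfer) (simp add: eq)
  qed
  have val: "(LBINT r:{0<..}. f k r) = of_real ((- u) ^ k / fact k) *
      (of_real (Gamma (q k)) * exp (\<i> * of_real (pi * q k)))" for k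
  proof -
    have "(LBINT r:{0<..}. f k r) =
        (LBINT r:{0<..}. c k * (of_real r powr (of_real (q k) - 1) * exp (- (- E * of_real r))))"
      by (intro set_lebesgue_integral_cong) (auto simp: eq)
    also have "\<dots> = c k * (Gamma (of_real (q k)) * (- E) powr (- of_real (q k)))"
      using q RE by (subst set_integral_mult_right, subst Gamma_integral_scaled(2)) auto
    also have "\<dots> = of_real ((- u) ^ k / fact k) * (of_real (Gamma (q k)) *
        (B powr (of_nat k + 1) * (- E) powr (- (of_real b * (of_nat k + 1)))))"
    proof -
      have "B ^ (k + 1) = B powr of_nat (k + 1)"
        by (subst powr_nat) (auto simp: B_def)
      also have "of_nat (k + 1) = (of_nat k + 1 :: complex)" by simp
      finally have "B ^ (k + 1) = B powr (of_nat k + 1)" .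
      moreover have "complex_of_real (q k) = of_real b * (of_nat k + 1)" by (simp add: q_def)
      ultimately show ?thesis by (simp only: c_def Gamma_complex_of_real [symmetric] mult_ac)
    qed
    also have "\<dots> = of_real ((- u) ^ k / fact k) * (of_real (Gamma (q k)) * exp (\<i> * of_real (pi * q k)))"
      unfolding B_E_powr by (simp add: q_def algebra_simps)
    finally show ?thesis .
  qed
  have Imval: "Im (LBINT r:{0<..}. f k r) / pi = (- u) ^ k / fact k * rGamma (1 - q k)" for k
  proof -
    have "complex_of_real (rGamma (q k) * rGamma (1 - q k)) = of_real (sin (pi * q k) / pi)"
      using rGamma_reflection_complex[of "of_real (q k)"]
      by (simp add: rGamma_complex_of_real [symmetric] sin_of_real [symmetric] del: sin_of_real)
    hence "rGamma (q k) * rGamma (1 - q k) = sin (pi * q k) / pi"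
      by (simp only: of_real_eq_iff)
    moreover have "Gamma (q k) * rGamma (q k) = 1"
      using Gamma_real_pos[OF q[of k]] by (simp add: rGamma_inverse_Gamma)
    ultimately have "rGamma (1 - q k) = Gamma (q k) * sin (pi * q k) / pi"
      by (metis mult.assoc mult_1 times_divide_eq_right)
    moreover have "exp (\<i> * of_real (pi * q k)) = cis (pi * q k)" by (simp add: cis_conv_exp)
    ultimately show ?thesis unfolding val by (simp del: of_real_power of_real_divide of_real_mult)
  qed
  \<comment> \<open>Half of the decay rate - Re E is spent on exp (|u| r^b), which bounds all
    partial sums; the other half keeps the common majorant integrable.\<close>
  obtain K where K: "\<And>r. r > 0 \<Longrightarrow> \<bar>u\<bar> * r powr b \<le> (- Re E / 2) * r + K"
    using powr_less_one_le_linear[of b "- Re E / 2" "\<bar>u\<bar>"] b Re_E_neg by auto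
  have bound: "norm (\<Sum>k<n. f k r) \<le> exp K * (r powr (b - 1) * exp (- (- Re E / 2 * r)))"
    if r: "r > 0" for n r
  proof -
    have nf: "norm (f k r) = r powr (b - 1) * exp (Re E * r) * ((\<bar>u\<bar> * r powr b) ^ k /\<^sub>R fact k)" for k
      using r by (simp add: f_def norm_mult norm_power B_def mult_ac)
    have "norm (\<Sum>k<n. f k r) \<le> (\<Sum>k<n. norm (f k r))" by (rule norm_sum)
    also have "\<dots> = r powr (b - 1) * exp (Re E * r) * (\<Sum>k<n. (\<bar>u\<bar> * r powr b) ^ k /\<^sub>R fact k)"
      unfolding nf by (rule sum_distrib_left [symmetric])
    also have "(\<Sum>k<n. (\<bar>u\<bar> * r powr b) ^ k /\<^sub>R fact k) \<le> exp (\<bar>u\<bar> * r powr b)"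
      unfolding exp_def by (intro sum_le_suminf summable_exp_generic) auto
    also have "\<dots> \<le> exp ((- Re E / 2) * r + K)" using K[OF r] by simp
    finally have "norm (\<Sum>k<n. f k r) \<le> r powr (b - 1) * (exp (Re E * r) * exp ((- Re E / 2) * r + K))"
      by (simp add: mult_left_mono mult.assoc)
    also have "exp (Re E * r) * exp ((- Re E / 2) * r + K) = exp K * exp (- (- Re E / 2 * r))"
      by (simp add: algebra_simps flip: exp_add)
    finally show ?thesis by (simp only: mult_ac)
  qed
  have "(\<lambda>n. LBINT r. indicator {0<..} r *\<^sub>R (\<Sum>k<n. f k r)) \<longlonglongrightarrow> (LBINT r. indicator {0<..} r *\<^sub>R wright_ray u r)"
  proof (rule integral_dominated_convergence)
    show "(\<lambda>r. indicator {0<..} r *\<^sub>R wright_ray u r) \<in> borel_measurable lborel"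
      using set_borel_measurable_lborel[OF _ continuous_on_wright_ray]
      by (simp add: set_borel_measurable_def)
    show "(\<lambda>r. indicator {0<..} r *\<^sub>R (\<Sum>k<n. f k r)) \<in> borel_measurable lborel" for n
      using int unfolding set_integrable_def scaleR_right.sum
      by (intro borel_measurable_sum borel_measurable_integrable)
    show "integrable lborel (\<lambda>r. indicator {0<..} r *\<^sub>R (exp K * (r powr (b - 1) * exp (- (- Re E / 2 * r)))))"
      using set_integrable_mult_right[OF Gamma_integral_scaled_real(1)[of b "- Re E / 2"], of "exp K"] b Re_E_neg
      by (simp add: set_integrable_def)
    show "AE r in lborel. norm (indicator {0<..} r *\<^sub>R (\<Sum>k<n. f k r))
        \<le> indicator {0<..} r *\<^sub>R (exp K * (r powr (b - 1) * exp (- (- Re E / 2 * r))))" for n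
      using bound[of _ n] by (intro AE_I2) (auto simp: indicator_def)
    show "AE r in lborel. (\<lambda>n. indicator {0<..} r *\<^sub>R (\<Sum>k<n. f k r)) \<longlonglongrightarrow> indicator {0<..} r *\<^sub>R wright_ray u r"
    proof (intro AE_I2 tendsto_intros)
      fix r :: real
      have "(\<lambda>k. f k r) sums wright_ray u r"
        unfolding f_def wright_ray_altdef by (intro sums_mult exp_converges)
      thus "(\<lambda>n. \<Sum>k<n. f k r) \<longlonglongrightarrow> wright_ray u r" by (simp add: sums_def)
    qed
  qed
  also have "(\<lambda>n. LBINT r. indicator {0<..} r *\<^sub>R (\<Sum>k<n. f k r)) = (\<lambda>n. \<Sum>k<n. LBINT r:{0<..}. f k r)"
    using int unfolding set_integrable_def set_lebesgue_integral_def scaleR_right.sum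
    by (subst Bochner_Integration.integral_sum) auto
  finally have "(\<lambda>k. LBINT r:{0<..}. f k r) sums (LBINT r:{0<..}. wright_ray u r)"
    by (simp add: sums_def set_lebesgue_integral_def)
  hence "(\<lambda>k. Im (LBINT r:{0<..}. f k r) / pi) sums (Im (LBINT r:{0<..}. wright_ray u r) / pi)"
    by (intro sums_divide sums_Im)
  thus ?thesis unfolding Imval q_def .
qed

lemma mwright_ray: "mwright b u = Im (LBINT r:{0<..}. wright_ray u r) / pi"
  using mwright_sums_ray[of u] by (simp add: mwright_def sums_iff)

lemma continuous_on_mwright: "continuous_on {0<..} (mwright b)"
proof -
  have "continuous_on {0<..} (\<lambda>u. LBINT r:{0<..}. wright_ray u r)"
  proof (rule continuous_on_LBINT_pos)
    show "set_integrable lborel {0<..} (\<lambda>r. r powr (b - 1) * exp (- (- Re E * r)))"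
      using Gamma_integral_scaled_real(1)[of b "- Re E"] b Re_E_neg by simp
    show "continuous_on {0<..} (\<lambda>u. wright_ray u r)" if "r > 0" for r
      using that unfolding wright_ray_altdef by (auto intro!: continuous_intros)
  qed (use norm_wright_ray_le continuous_on_wright_ray in auto)
  hence "continuous_on {0<..} (\<lambda>u. Im (LBINT r:{0<..}. wright_ray u r) / pi)"
    by (intro continuous_intros) auto
  thus ?thesis unfolding mwright_ray .
qed

text \<open>Bounding exp (- u r^b Re B) by a power pulls out u^(-\<beta>) and leaves r^(b (1 -
  \<beta>) - 1), integrable at 0 exactly for \<beta> < 1. Later \<beta> = 0 gives boundedness and
  \<beta> = 1/2 the decay that fits the Mellin line.\<close>

lemma mwright_bound:
  assumes \<beta>: "0 \<le> \<beta>" "\<beta> < 1"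
  obtains C where "C \<ge> 0" "\<And>u. u > 0 \<Longrightarrow> \<bar>mwright b u\<bar> \<le> C * u powr (- \<beta>)"
proof
  let ?I = "LBINT r:{0<..}. r powr (b * (1 - \<beta>) - 1) * exp (- (- Re E * r))"
  have int: "set_integrable lborel {0<..} (\<lambda>r. r powr (b * (1 - \<beta>) - 1) * exp (- (- Re E * r)))"
    using Gamma_integral_scaled_real(1)[of "b * (1 - \<beta>)" "- Re E"] b Re_E_neg \<beta> by simp
  show "0 \<le> Re B powr (- \<beta>) * ?I / pi"
    by (auto intro!: divide_nonneg_pos mult_nonneg_nonneg Bochner_Integration.integral_nonneg
        simp: set_lebesgue_integral_def)
  fix u :: real assume u: "u > 0"
  have "\<bar>Im (LBINT r:{0<..}. wright_ray u r)\<bar> \<le> norm (LBINT r:{0<..}. wright_ray u r)"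
    by (rule abs_Im_le_cmod)
  also have "\<dots> \<le> (LBINT r:{0<..}. norm (wright_ray u r))"
    using set_integrable_wright_ray[of u] u by (intro set_integral_norm_bound) auto
  also have "\<dots> \<le> (LBINT r:{0<..}. (u powr (- \<beta>) * Re B powr (- \<beta>)) * (r powr (b * (1 - \<beta>) - 1) * exp (- (- Re E * r))))"
  proof (rule set_integral_mono)
    show "set_integrable lborel {0<..} (\<lambda>r. norm (wright_ray u r))"
      using set_integrable_wright_ray[of u] u by (intro set_integrable_norm) auto
    show "set_integrable lborel {0<..} (\<lambda>r. (u powr (- \<beta>) * Re B powr (- \<beta>)) * (r powr (b * (1 - \<beta>) - 1) * exp (- (- Re E * r))))"
      using int by (rule set_integrable_mult_right)
    fix r :: real assume "r \<in> {0<..}"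
    hence r: "r > 0" by simp
    have "exp (- (u * r powr b * Re B)) \<le> (u * r powr b * Re B) powr (- \<beta>)"
      using u r Re_B_pos \<beta> by (intro exp_minus_le_powr) auto
    also have "\<dots> = u powr (- \<beta>) * Re B powr (- \<beta>) * r powr (- (b * \<beta>))"
      using u r Re_B_pos by (simp add: powr_mult powr_powr mult_ac)
    finally have "norm (wright_ray u r) \<le> r powr (b - 1) * exp (- (- Re E * r)) *
        (u powr (- \<beta>) * Re B powr (- \<beta>) * r powr (- (b * \<beta>)))"
      unfolding norm_wright_ray by (intro mult_left_mono) auto
    also have "\<dots> = (u powr (- \<beta>) * Re B powr (- \<beta>)) * (r powr (b * (1 - \<beta>) - 1) * exp (- (- Re E * r)))"
    proof -
      have "r powr (b * (1 - \<beta>) - 1) = r powr (b - 1) * r powr (- (b * \<beta>))"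
        by (simp add: algebra_simps flip: powr_add)
      thus ?thesis by (simp only: mult_ac)
    qed
    finally show "norm (wright_ray u r) \<le> \<dots>" .
  qed
  also have "\<dots> = (u powr (- \<beta>) * Re B powr (- \<beta>)) * ?I" by (rule set_integral_mult_right)
  finally show "\<bar>mwright b u\<bar> \<le> Re B powr (- \<beta>) * ?I / pi * u powr (- \<beta>)"
    by (simp add: mwright_ray field_simps)
qed

text \<open>After the exchange, the integral over \<open>u\<close> is Euler's with rate r^b B and
  the one over \<open>r\<close> is Euler's with rate - E. They require Re \<sigma> > 0 and Re
  \<sigma> < 1 respectively, which is the origin of the strip.\<close>

lemma mellin_wright_ray:
  assumes \<sigma>: "0 < Re \<sigma>" "Re \<sigma> < 1"
  defines "q \<equiv> of_real b * (1 - \<sigma>)"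
  shows "set_integrable lborel {0<..} (\<lambda>u. of_real u powr (\<sigma> - 1) * (LBINT r:{0<..}. wright_ray u r))"
    and "(LBINT u:{0<..}. of_real u powr (\<sigma> - 1) * (LBINT r:{0<..}. wright_ray u r))
           = Gamma \<sigma> * Gamma q * exp (\<i> * of_real pi * q)"
proof -
  let ?x = "Re \<sigma>"
  let ?f = "\<lambda>r u. of_real u powr (\<sigma> - 1) * wright_ray u r"
  let ?g = "\<lambda>r u. (r powr (b - 1) * exp (- (- Re E * r))) * (u powr (?x - 1) * exp (- ((r powr b * Re B) * u)))"
  have cont: "continuous_on ({0<..} \<times> {0<..}) (\<lambda>(r, u). ?f r u)"
    unfolding wright_ray_altdef split_def by (auto intro!: continuous_intros)
  have bound: "norm (?f r u) \<le> ?g r u" if "r > 0" "u > 0" for r u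
    using that by (simp add: norm_mult norm_wright_ray norm_powr_real_powr mult_ac)
  have int_g: "set_integrable lborel {0<..} (?g r)" if "r > 0" for r
    using that Re_B_pos \<sigma> by (intro set_integrable_mult_right Gamma_integral_scaled_real(1)) auto
  have val_g: "(LBINT u:{0<..}. ?g r u) = (Gamma ?x * Re B powr (- ?x)) * (r powr (b * (1 - ?x) - 1) * exp (- (- Re E * r)))"
    if r: "r > 0" for r
  proof -
    have "(LBINT u:{0<..}. ?g r u) = (r powr (b - 1) * exp (- (- Re E * r))) * (Gamma ?x * (r powr b * Re B) powr (- ?x))"
      using r Re_B_pos \<sigma> by (subst set_integral_mult_right, subst Gamma_integral_scaled_real(2)) auto
    moreover have "(r powr b * Re B) powr (- ?x) = Re B powr (- ?x) * r powr (- (b * ?x))"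
      using r Re_B_pos by (simp add: powr_mult powr_powr mult_ac)
    moreover have "r powr (b * (1 - ?x) - 1) = r powr (b - 1) * r powr (- (b * ?x))"
      by (simp add: algebra_simps flip: powr_add)
    ultimately show ?thesis by (simp only: mult_ac)
  qed
  have int_int_g: "set_integrable lborel {0<..} (\<lambda>r. LBINT u:{0<..}. ?g r u)"
  proof -
    have "set_integrable lborel {0<..} (\<lambda>r. (Gamma ?x * Re B powr (- ?x)) * (r powr (b * (1 - ?x) - 1) * exp (- (- Re E * r))))"
      using Re_E_neg b \<sigma> by (intro set_integrable_mult_right Gamma_integral_scaled_real(1)) auto
    thus ?thesis by (rule set_integrable_transfer) (simp only: val_g greaterThan_iff)
  qed
  note fubini = set_Fubini_pos[OF cont bound int_g int_int_g]
  show "set_integrable lborel {0<..} (\<lambda>u. of_real u powr (\<sigma> - 1) * (LBINT r:{0<..}. wright_ray u r))"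
    using fubini(2) by simp
  have inner: "(LBINT u:{0<..}. ?f r u) = (Gamma \<sigma> * B powr (1 - \<sigma>)) * (of_real r powr (q - 1) * exp (- (- E * of_real r)))"
    if r: "r > 0" for r
  proof -
    let ?w = "of_real (r powr b) * B"
    have "(LBINT u:{0<..}. ?f r u) = (LBINT u:{0<..}. (exp (of_real r * E) * B * of_real (r powr (b - 1))) *
        (of_real u powr (\<sigma> - 1) * exp (- (?w * of_real u))))"
      by (intro set_lebesgue_integral_cong) (auto simp: wright_ray_altdef mult_ac)
    also have "\<dots> = (exp (of_real r * E) * B * of_real (r powr (b - 1))) * (Gamma \<sigma> * ?w powr (- \<sigma>))"
      using r Re_B_pos \<sigma> by (subst set_integral_mult_right, subst Gamma_integral_scaled(2)) auto
    also have "?w powr (- \<sigma>) = of_real (r powr b) powr (- \<sigma>) * B powr (- \<sigma>)"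
      using r Re_B_pos by (intro powr_times_of_real_left) auto
    also have "of_real (r powr b) powr (- \<sigma>) = complex_of_real r powr (- (of_real b * \<sigma>))"
    proof -
      have "complex_of_real (r powr b) = of_real r powr of_real b" using r by (simp add: powr_of_real)
      moreover have "Ln (of_real (r powr b)) = of_real b * Ln (complex_of_real r)"
        using r by (simp add: Ln_of_real ln_powr)
      ultimately show ?thesis using r by (simp add: powr_def mult_ac)
    qed
    finally have "(LBINT u:{0<..}. ?f r u) = Gamma \<sigma> * (B * B powr (- \<sigma>)) *
        (of_real (r powr (b - 1)) * of_real r powr (- (of_real b * \<sigma>)) * exp (- (- E * of_real r)))"
      by (simp add: mult_ac)
    moreover have "B * B powr (- \<sigma>) = B powr (1 - \<sigma>)"
      using Re_B_pos by (auto simp: powr_diff powr_minus field_simps)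
    moreover have "of_real (r powr (b - 1)) * of_real r powr (- (of_real b * \<sigma>)) = complex_of_real r powr (q - 1)"
    proof -
      have "complex_of_real (r powr (b - 1)) = of_real r powr (of_real b - 1)"
        using r by (subst powr_of_real [symmetric]) auto
      moreover have "q - 1 = (of_real b - 1) + (- (of_real b * \<sigma>))"
        by (simp add: q_def algebra_simps)
      ultimately show ?thesis by (simp only: powr_add)
    qed
    ultimately show ?thesis by simp
  qed
  have "(LBINT u:{0<..}. of_real u powr (\<sigma> - 1) * (LBINT r:{0<..}. wright_ray u r))
      = (LBINT r:{0<..}. LBINT u:{0<..}. ?f r u)"
    using fubini(1) by simp
  also have "\<dots> = (LBINT r:{0<..}. (Gamma \<sigma> * B powr (1 - \<sigma>)) * (of_real r powr (q - 1) * exp (- (- E * of_real r))))"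
    by (intro set_lebesgue_integral_cong) (auto simp: inner)
  also have "\<dots> = Gamma \<sigma> * B powr (1 - \<sigma>) * (Gamma q * (- E) powr (- q))"
    using Re_E_neg b \<sigma> by (subst set_integral_mult_right, subst Gamma_integral_scaled(2)) (auto simp: q_def)
  also have "\<dots> = Gamma \<sigma> * Gamma q * exp (\<i> * of_real pi * q)"
    using B_E_powr[of "1 - \<sigma>"] by (simp add: q_def mult_ac)
  finally show "(LBINT u:{0<..}. of_real u powr (\<sigma> - 1) * (LBINT r:{0<..}. wright_ray u r))
           = Gamma \<sigma> * Gamma q * exp (\<i> * of_real pi * q)" .
qed

text \<open>Taking imaginary parts does not commute with complex weights, so Im A is written as (A -
  cnj A) / (2 i). The conjugate part comes from the previous result at cnj \<sigma>; the two phases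
  then combine to sin (pi q), and reflection finishes.\<close>

theorem mellin_mwright:
  assumes \<sigma>: "0 < Re \<sigma>" "Re \<sigma> < 1"
  shows "set_integrable lborel {0<..} (\<lambda>u. of_real u powr (\<sigma> - 1) * of_real (mwright b u))"
    and "(LBINT u:{0<..}. of_real u powr (\<sigma> - 1) * of_real (mwright b u))
           = Gamma \<sigma> * rGamma (1 - of_real b * (1 - \<sigma>))"
proof -
  define A where "A = (\<lambda>u. LBINT r:{0<..}. wright_ray u r)"
  define q where "q = of_real b * (1 - \<sigma>)"
  have \<sigma>': "0 < Re (cnj \<sigma>)" "Re (cnj \<sigma>) < 1" using \<sigma> by auto
  have cnj: "cnj (of_real u powr (cnj \<sigma> - 1) * A u) = of_real u powr (\<sigma> - 1) * cnj (A u)" if "u > 0" for u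
    using that by (simp add: powr_def exp_cnj Ln_of_real)
  have int2: "set_integrable lborel {0<..} (\<lambda>u. of_real u powr (\<sigma> - 1) * cnj (A u))"
  proof -
    have "set_integrable lborel {0<..} (\<lambda>u. cnj (of_real u powr (cnj \<sigma> - 1) * A u))"
      using mellin_wright_ray(1)[OF \<sigma>'] unfolding A_def set_integrable_def
      by (subst complex_integrable_cnj [symmetric]) (simp add: scaleR_conv_of_real)
    thus ?thesis by (rule set_integrable_transfer) (simp only: cnj greaterThan_iff)
  qed
  have val2: "(LBINT u:{0<..}. of_real u powr (\<sigma> - 1) * cnj (A u)) = Gamma \<sigma> * Gamma q * exp (- (\<i> * of_real pi * q))"
  proof -
    have "(LBINT u:{0<..}. of_real u powr (\<sigma> - 1) * cnj (A u)) = (LBINT u:{0<..}. cnj (of_real u powr (cnj \<sigma> - 1) * A u))"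
      by (intro set_lebesgue_integral_cong allI impI) (simp, simp only: cnj greaterThan_iff)
    also have "\<dots> = cnj (LBINT u:{0<..}. of_real u powr (cnj \<sigma> - 1) * A u)"
      unfolding set_lebesgue_integral_def by (subst Bochner_Integration.integral_cnj [symmetric]) (simp add: scaleR_conv_of_real)
    also have "\<dots> = Gamma \<sigma> * Gamma q * exp (- (\<i> * of_real pi * q))"
      using mellin_wright_ray(2)[OF \<sigma>'] unfolding A_def
      by (simp add: q_def cnj_Gamma exp_cnj)
    finally show ?thesis .
  qed
  have eq: "of_real u powr (\<sigma> - 1) * of_real (mwright b u) =
      (of_real u powr (\<sigma> - 1) * A u - of_real u powr (\<sigma> - 1) * cnj (A u)) / (2 * \<i> * of_real pi)" for u
  proof -
    have "of_real (mwright b u) = (A u - cnj (A u)) / (2 * \<i> * of_real pi)"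
      using complex_diff_cnj[of "A u"] by (simp add: mwright_ray A_def)
    thus ?thesis by (simp only: times_divide_eq_right right_diff_distrib)
  qed
  have int1: "set_integrable lborel {0<..} (\<lambda>u. of_real u powr (\<sigma> - 1) * A u)"
    using mellin_wright_ray(1)[OF \<sigma>] by (simp add: A_def)
  show "set_integrable lborel {0<..} (\<lambda>u. of_real u powr (\<sigma> - 1) * of_real (mwright b u))"
    unfolding eq by (intro set_integrable_divide set_integral_diff int1 int2)
  have "(LBINT u:{0<..}. of_real u powr (\<sigma> - 1) * of_real (mwright b u)) =
      (Gamma \<sigma> * Gamma q * exp (\<i> * of_real pi * q) - Gamma \<sigma> * Gamma q * exp (- (\<i> * of_real pi * q))) / (2 * \<i> * of_real pi)"
    unfolding eq set_integral_divide_zero set_integral_diff(2)[OF int1 int2] val2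
    using mellin_wright_ray(2)[OF \<sigma>] by (simp add: A_def q_def)
  also have "\<dots> = Gamma \<sigma> * (Gamma q * (sin (of_real pi * q) / of_real pi))"
    by (simp add: sin_exp_eq field_simps)
  also have "\<dots> = Gamma \<sigma> * (Gamma q * (rGamma q * rGamma (1 - q)))"
    by (simp add: rGamma_reflection_complex)
  also have "\<dots> = Gamma \<sigma> * rGamma (1 - q)"
  proof -
    have "Re q > 0" using b \<sigma> by (simp add: q_def)
    from Gamma_mult_rGamma[OF this] show ?thesis by (simp add: mult.assoc [symmetric])
  qed
  finally show "(LBINT u:{0<..}. of_real u powr (\<sigma> - 1) * of_real (mwright b u))
           = Gamma \<sigma> * rGamma (1 - of_real b * (1 - \<sigma>))" by (simp add: q_def)
qed

end

section \<open>Uniqueness of Mellin transforms\<close>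

lemma std_normal_fourier:
  "(LBINT z. complex_of_real (std_normal_density z) * iexp (s * z)) = of_real (exp (- s\<^sup>2 / 2))"
proof -
  have "char std_normal_distribution s = (LBINT z. std_normal_density z *\<^sub>R iexp (s * z))"
    unfolding char_def by (subst integral_density) (auto simp: normal_density_nonneg)
  thus ?thesis using char_std_normal_distribution by (simp add: scaleR_conv_of_real)
qed

text \<open>Gaussian smoothing: every convolution of \<open>h\<close> with a Gaussian vanishes,
  because it is a weighted integral of the Fourier transform. Letting the width shrink recovers h x
  by continuity and boundedness.\<close>

lemma fourier_eq_0_imp_eq_0:
  fixes h :: "real \<Rightarrow> real"
  assumes int: "integrable lborel h" and cont: "continuous_on UNIV h" and bound: "\<And>x. \<bar>h x\<bar> \<le> C"
    and zero: "\<And>\<tau>. (LBINT x. iexp (\<tau> * x) * of_real (h x)) = 0"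
  shows "h x = 0"
proof -
  have hm [measurable]: "h \<in> borel_measurable borel"
    using cont by (rule borel_measurable_continuous_onI)
  have smooth: "(LBINT z. std_normal_density z * h (x + \<epsilon> * z)) = 0" if \<epsilon>: "\<epsilon> > 0" for \<epsilon>
  proof -
    \<comment> \<open>Integrating over \<open>y\<close> first produces the transform of
      \<open>h\<close> at \<tau>/\<epsilon>, which is 0; integrating over \<tau> first produces a
      Gaussian in \<open>y\<close> of width \<epsilon> around \<open>x\<close>.\<close>
    define F where "F = (\<lambda>\<tau> y. complex_of_real (std_normal_density \<tau>) * iexp (\<tau> * ((y - x) / \<epsilon>)) * of_real (h y))"
    have normF: "norm (F \<tau> y) = std_normal_density \<tau> * \<bar>h y\<bar>" for \<tau> y
      by (simp add: F_def norm_mult)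
    have [measurable]: "(\<lambda>(\<tau>, y). F \<tau> y) \<in> borel_measurable (lborel \<Otimes>\<^sub>M lborel)"
      unfolding F_def by measurable
    have intF: "integrable (lborel \<Otimes>\<^sub>M lborel) (\<lambda>(\<tau>, y). F \<tau> y)"
    proof (rule lborel_pair.Fubini_integrable)
      show "integrable lborel (\<lambda>\<tau>. LBINT y. norm (case (\<tau>, y) of (\<tau>, y) \<Rightarrow> F \<tau> y))"
        by (simp add: normF)
      show "AE \<tau> in lborel. integrable lborel (\<lambda>y. case (\<tau>, y) of (\<tau>, y) \<Rightarrow> F \<tau> y)"
      proof (intro AE_I2)
        fix \<tau> :: real
        have "integrable lborel (\<lambda>y. std_normal_density \<tau> * h y)" using int by simp
        thus "integrable lborel (\<lambda>y. case (\<tau>, y) of (\<tau>, y) \<Rightarrow> F \<tau> y)"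
        proof (rule Bochner_Integration.integrable_bound)
          show "(\<lambda>y. case (\<tau>, y) of (\<tau>, y) \<Rightarrow> F \<tau> y) \<in> borel_measurable lborel"
            unfolding F_def by simp
        qed (simp add: normF abs_mult)
      qed
    qed simp
    have inner: "(LBINT y. F \<tau> y) = 0" for \<tau>
    proof -
      have "F \<tau> y = (of_real (std_normal_density \<tau>) * iexp (- (\<tau> * x / \<epsilon>))) * (iexp (\<tau> / \<epsilon> * y) * of_real (h y))" for y
      proof -
        have "iexp (\<tau> * ((y - x) / \<epsilon>)) = iexp (- (\<tau> * x / \<epsilon>)) * iexp (\<tau> / \<epsilon> * y)"
          using \<epsilon> by (simp add: field_simps flip: exp_add)
        thus ?thesis by (simp add: F_def)
      qed
      hence "(LBINT y. F \<tau> y) = (of_real (std_normal_density \<tau>) * iexp (- (\<tau> * x / \<epsilon>))) *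
          (LBINT y. iexp (\<tau> / \<epsilon> * y) * of_real (h y))"
        by (simp only: integral_mult_right_zero)
      thus ?thesis by (simp only: zero mult_zero_right)
    qed
    have inner': "(LBINT \<tau>. F \<tau> y) = of_real (exp (- ((y - x) / \<epsilon>)\<^sup>2 / 2) * h y)" for y
    proof -
      have "(LBINT \<tau>. F \<tau> y) = (LBINT \<tau>. complex_of_real (std_normal_density \<tau>) * iexp ((y - x) / \<epsilon> * \<tau>)) * of_real (h y)"
        by (simp add: F_def mult.commute)
      thus ?thesis unfolding std_normal_fourier unfolding of_real_mult .
    qed
    have "complex_of_real (LBINT y. exp (- ((y - x) / \<epsilon>)\<^sup>2 / 2) * h y) = (LBINT y. LBINT \<tau>. F \<tau> y)"
      by (simp only: inner' integral_complex_of_real)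
    also have "\<dots> = (LBINT \<tau>. LBINT y. F \<tau> y)"
      by (rule lborel_pair.Fubini_integral[OF intF])
    also have "\<dots> = 0" by (simp add: inner)
    finally have "(LBINT y. exp (- ((y - x) / \<epsilon>)\<^sup>2 / 2) * h y) = 0"
      by (simp only: of_real_eq_0_iff)
    also have "(LBINT y. exp (- ((y - x) / \<epsilon>)\<^sup>2 / 2) * h y) = \<epsilon> * (LBINT z. exp (- z\<^sup>2 / 2) * h (x + \<epsilon> * z))"
      using \<epsilon> by (subst lborel_integral_real_affine[where c = \<epsilon> and t = x]) auto
    finally have "(LBINT z. exp (- z\<^sup>2 / 2) * h (x + \<epsilon> * z)) = 0" using \<epsilon> by simp
    thus ?thesis by (simp add: std_normal_density_def)
  qed
  have "(\<lambda>n. LBINT z. std_normal_density z * h (x + 1 / real (Suc n) * z)) \<longlonglongrightarrow> (LBINT z. std_normal_density z * h x)"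
  proof (rule integral_dominated_convergence)
    show "integrable lborel (\<lambda>z. std_normal_density z * C)" by simp
    show "AE z in lborel. (\<lambda>n. std_normal_density z * h (x + 1 / real (Suc n) * z)) \<longlonglongrightarrow> std_normal_density z * h x"
    proof (intro AE_I2 tendsto_intros)
      fix z :: real
      have "(\<lambda>n. x + 1 / real (Suc n) * z) \<longlonglongrightarrow> x" by real_asymp
      moreover have "isCont h x" using cont by (simp add: continuous_on_eq_continuous_at)
      ultimately show "(\<lambda>n. h (x + 1 / real (Suc n) * z)) \<longlonglongrightarrow> h x"
        by (rule isCont_tendsto_compose [rotated])
    qed
    show "AE z in lborel. norm (std_normal_density z * h (x + 1 / real (Suc n) * z)) \<le> std_normal_density z * C" for n
      using bound by (intro AE_I2) (simp add: abs_mult mult_left_mono)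
  qed measurable
  hence "(LBINT z. std_normal_density z * h x) = 0"
    using smooth[of "1 / real (Suc _)"] by (simp add: LIMSEQ_const_iff del: of_nat_Suc)
  thus ?thesis by simp
qed

theorem mellin_eq_0_imp_eq_0:
  fixes D :: "real \<Rightarrow> real"
  assumes cont: "continuous_on {0<..} D"
    and bound: "\<And>y. y > 0 \<Longrightarrow> \<bar>D y\<bar> \<le> C * y powr (- (1 / 2))"
    and int: "\<And>\<sigma>. Re \<sigma> = 1 / 2 \<Longrightarrow> set_integrable lborel {0<..} (\<lambda>y. of_real y powr (\<sigma> - 1) * of_real (D y))"
    and zero: "\<And>\<sigma>. Re \<sigma> = 1 / 2 \<Longrightarrow> (LBINT y:{0<..}. of_real y powr (\<sigma> - 1) * of_real (D y)) = 0"
    and y: "y > 0"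
  shows "D y = 0"
proof -
  define h where "h = (\<lambda>x. exp (x / 2) * D (exp x))"
  have ch: "continuous_on UNIV h"
    unfolding h_def by (auto intro!: continuous_intros continuous_on_compose2[OF cont])
  have bh: "\<bar>h x\<bar> \<le> C" for x
  proof -
    have "\<bar>h x\<bar> \<le> exp (x / 2) * (C * exp x powr (- (1 / 2)))"
      unfolding h_def abs_mult using bound[of "exp x"] by (simp add: mult_left_mono)
    also have "\<dots> = C" by (simp add: powr_def exp_minus)
    finally show ?thesis .
  qed
  have img: "exp ` UNIV = {0::real<..}" by (auto simp: image_iff) (metis exp_ln)
  have deriv: "(exp has_field_derivative exp x) (at x)" for x :: real by (rule DERIV_exp)
  have inj: "inj (exp :: real \<Rightarrow> real)" by (simp add: inj_def)
  have eq: "exp x *\<^sub>R (of_real (exp x) powr (1 / 2 + \<i> * of_real \<tau> - 1) * of_real (D (exp x)))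
      = iexp (\<tau> * x) * of_real (h x)" for \<tau> x
  proof -
    have L: "Ln (complex_of_real (exp x)) = of_real x" by (simp add: Ln_of_real)
    have "complex_of_real (exp x) * of_real (exp x) powr (1 / 2 + \<i> * of_real \<tau> - 1)
        = exp (of_real x) * exp ((1 / 2 + \<i> * of_real \<tau> - 1) * of_real x)"
      unfolding powr_def L by (simp add: exp_of_real)
    also have "\<dots> = iexp (\<tau> * x) * of_real (exp (x / 2))"
      unfolding exp_of_real [symmetric] exp_add [symmetric] by (simp add: field_simps)
    finally show ?thesis by (simp add: h_def scaleR_conv_of_real mult.assoc [symmetric])
  qed
  have cf: "continuous_on {0<..} (\<lambda>y. of_real y powr (\<sigma> - 1) * complex_of_real (D y))" for \<sigma>
    using cont by (auto intro!: continuous_intros)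
  note cv = lborel_change_of_variables[OF _ _ img cf _ deriv inj]
  have "integrable lborel (\<lambda>x. iexp (0 * x) * of_real (h x))"
    using cv(1)[of "1 / 2 + \<i> * of_real 0"] int[of "1 / 2 + \<i> * of_real 0"]
    by (simp only: abs_exp_cancel eq set_integrable_def) (simp add: continuous_intros)
  hence ih: "integrable lborel h" by (simp add: complex_of_real_integrable_eq)
  have zh: "(LBINT x. iexp (\<tau> * x) * of_real (h x)) = 0" for \<tau>
    using cv(2)[of "1 / 2 + \<i> * of_real \<tau>"] zero[of "1 / 2 + \<i> * of_real \<tau>"]
    by (simp only: abs_exp_cancel eq set_lebesgue_integral_def) (simp add: continuous_intros)
  have "h (ln y) = 0"
    by (rule fourier_eq_0_imp_eq_0[OF ih ch bh zh])
  thus ?thesis using y by (simp add: h_def)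
qed

section \<open>The density of the product of the integration variables\<close>

text \<open>Euler's integral after r = s^3. The exponent is parametrised as 3 w - 1 so that the
  result is a Gamma value at \<open>w\<close>.\<close>

lemma Gamma_integral_cubic:
  assumes w: "Re w > 0" and c: "c > 0"
  shows "set_integrable lborel {0<..} (\<lambda>s. of_real s powr (3 * w - 1) * of_real (exp (- (s ^ 3 / c))))"
    and "(LBINT s:{0<..}. of_real s powr (3 * w - 1) * of_real (exp (- (s ^ 3 / c))))
           = of_real c powr w * Gamma w / 3"
proof -
  define f where "f = (\<lambda>r. of_real r powr (w - 1) * exp (- (of_real (1 / c) * complex_of_real r)))"
  define g where "g = (\<lambda>s. of_real s powr (3 * w - 1) * complex_of_real (exp (- (s ^ 3 / c))))"
  have cf: "continuous_on {0<..} f" unfolding f_def using c by (auto intro!: continuous_intros)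
  have img: "(\<lambda>s. s ^ 3) ` {0::real<..} = {0<..}"
  proof safe
    fix r :: real assume "r > 0"
    thus "r \<in> (\<lambda>s. s ^ 3) ` {0<..}" by (intro image_eqI[of _ _ "root 3 r"]) auto
  qed auto
  have deriv: "((\<lambda>s. s ^ 3) has_field_derivative 3 * s ^ 2) (at s)" for s :: real
    by (auto intro!: derivative_eq_intros)
  have inj: "inj_on (\<lambda>s. s ^ 3) {0::real<..}"
    by (auto simp: inj_on_def intro: power_eq_imp_eq_base)
  have ch: "continuous_on {0<..} (\<lambda>s::real. 3 * s ^ 2)" by (auto intro!: continuous_intros)
  note cv = lborel_change_of_variables[OF _ _ img cf ch deriv inj]
  have eq: "\<bar>3 * s ^ 2\<bar> *\<^sub>R f (s ^ 3) = 3 * g s" if s: "s > 0" for s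
  proof -
    have L: "Ln (complex_of_real (s ^ 3)) = 3 * Ln (of_real s)"
      using s by (simp add: Ln_of_real ln_realpow flip: of_real_power)
    have "complex_of_real (s ^ 2) = exp (2 * Ln (of_real s))"
      using s by (simp add: Ln_of_real exp_of_real exp_double power2_eq_square)
    moreover have "complex_of_real (s ^ 3) powr (w - 1) = exp ((w - 1) * (3 * Ln (of_real s)))"
      using s unfolding powr_def L by simp
    moreover have "complex_of_real s powr (3 * w - 1) = exp ((3 * w - 1) * Ln (of_real s))"
      using s by (simp add: powr_def)
    ultimately have 1: "complex_of_real (s ^ 2) * complex_of_real (s ^ 3) powr (w - 1) = complex_of_real s powr (3 * w - 1)"
      by (simp add: algebra_simps flip: exp_add)
    have "exp (- (complex_of_real (1 / c) * of_real (s ^ 3))) = of_real (exp (- (s ^ 3 / c)))"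
      by (simp add: exp_of_real [symmetric])
    hence "\<bar>3 * s ^ 2\<bar> *\<^sub>R f (s ^ 3) = 3 * ((complex_of_real (s ^ 2) * complex_of_real (s ^ 3) powr (w - 1)) * of_real (exp (- (s ^ 3 / c))))"
      by (simp only: f_def scaleR_conv_of_real) simp
    thus ?thesis unfolding 1 g_def .
  qed
  have RE: "Re (of_real (1 / c)) > 0" using c by simp
  have fi: "set_integrable lborel {0<..} f"
    unfolding f_def by (rule Gamma_integral_scaled(1)[OF w RE])
  have "set_integrable lborel {0<..} (\<lambda>s. \<bar>3 * s ^ 2\<bar> *\<^sub>R f (s ^ 3))"
    by (rule cv(1)[THEN iffD2, OF _ _ fi]) auto
  hence "set_integrable lborel {0<..} (\<lambda>s. 3 * g s)"
    by (rule set_integrable_transfer) (simp only: eq greaterThan_iff)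
  thus "set_integrable lborel {0<..} g" by simp
  have "(LBINT s:{0<..}. 3 * g s) = (LBINT s:{0<..}. \<bar>3 * s ^ 2\<bar> *\<^sub>R f (s ^ 3))"
    by (intro set_lebesgue_integral_cong allI impI) (simp, simp only: eq greaterThan_iff)
  also have "\<dots> = (LBINT r:{0<..}. f r)" using cv(2) by simp
  also have "\<dots> = Gamma w * of_real (1 / c) powr (- w)"
    unfolding f_def by (rule Gamma_integral_scaled(2)[OF w RE])
  also have "complex_of_real (1 / c) powr (- w) = of_real c powr w"
  proof -
    have L: "Ln (complex_of_real (1 / c)) = - of_real (ln c)"
      using c by (subst Ln_of_real) (auto simp: ln_div)
    show ?thesis using c unfolding powr_def L by (simp add: Ln_of_real)
  qed
  finally show "(LBINT s:{0<..}. g s) = of_real c powr w * Gamma w / 3"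
    by (simp add: mult.commute)
qed

lemma set_integrable_powr_exp_cubic:
  fixes p c :: real
  assumes p: "p > -1" and c: "c > 0"
  shows "set_integrable lborel {0<..} (\<lambda>s. s powr p * exp (- (s ^ 3 / c)))"
proof -
  have e: "3 * complex_of_real ((p + 1) / 3) - 1 = of_real p" by (simp add: field_simps)
  have "set_integrable lborel {0<..} (\<lambda>s. norm (of_real s powr (3 * of_real ((p + 1) / 3) - 1) *
      complex_of_real (exp (- (s ^ 3 / c)))))"
    using p c by (intro set_integrable_norm Gamma_integral_cubic) auto
  thus ?thesis
    unfolding e by (rule set_integrable_transfer) (auto simp: norm_mult norm_powr_real_powr)
qed

text \<open>At fixed \<open>v\<close>, the substitution s = z / v has ds = dz / v. The moments found
  below show that this density has total mass 1.\<close>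

definition kern_density :: "real \<Rightarrow> real \<Rightarrow> real" where
  "kern_density t z = (LBINT v:{0<..}. kern t (z / v) v / v)"

section \<open>Bounds, continuity and moments of the density\<close>

context
  fixes t c K :: real
  assumes t: "t > 0"
  defines "c \<equiv> 3 * sqrt (3 * t)" and "K \<equiv> 3 / (2 * pi * sqrt t)"
begin

lemma kern_c_pos: "c > 0" and kern_K_pos: "K > 0"
  using t by (simp_all add: c_def K_def)

lemma kern_eq: "kern t s v = K * (s * exp (- (s ^ 3 / c))) * exp (- (v ^ 3 / c))"
proof -
  have "- (s ^ 3 + v ^ 3) / c = - (s ^ 3 / c) + - (v ^ 3 / c)"
    by (simp add: diff_divide_distrib)
  thus ?thesis unfolding kern_def c_def [symmetric] K_def [symmetric] by (simp only: exp_add mult.assoc)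
qed

text \<open>The factor z / v^2 is too singular at v = 0, and exp (- z^3 / (c v^3)) has to
  compensate. Bounding it by the power -\<beta> of its argument gives z^(1 - 3 \<beta>) v^(3 \<beta>
  - 2); \<beta> = 1/2 yields the power -1/2 wanted in \<open>z\<close> and also an integrable one in
  \<open>v\<close>.\<close>

lemma kern_density_bound_aux:
  assumes "z > 0" "v > 0"
  shows "0 \<le> kern t (z / v) v / v"
    and "kern t (z / v) v / v \<le> z powr (- (1 / 2)) * (K * sqrt c * (v powr (- (1 / 2)) * exp (- (v ^ 3 / c))))"
proof -
  show "0 \<le> kern t (z / v) v / v"
    using assms kern_K_pos by (simp add: kern_eq)
  let ?w = "(z / v) ^ 3 / c"
  have "exp (- ?w) \<le> ?w powr (- (1 / 2))"
  proof -
    have w: "?w > 0" using assms kern_c_pos by simp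
    have le: "?w powr (1 / 2) \<le> exp ?w"
    proof -
      have half: "(1 + W) / 2 \<le> 1 + W" if "W > 0" for W :: real using that by simp
      have "sqrt ?w \<le> (1 + ?w) / 2"
        using arith_geo_mean_sqrt[of 1 ?w] w by simp
      also have "\<dots> \<le> 1 + ?w" using w by (rule half)
      also have "\<dots> \<le> exp ?w" by (rule exp_ge_add_one_self)
      finally show ?thesis using w by (simp add: powr_half_sqrt)
    qed
    have "?w powr (1 / 2) > 0" using w by (metis powr_gt_zero less_irrefl)
    thus ?thesis using le_imp_inverse_le[OF le] by (simp only: exp_minus powr_minus)
  qed
  also have "?w powr (- (1 / 2)) = sqrt c * (z powr (- (3 / 2)) * v powr (3 / 2))"
  proof -
    have "(r ^ 3 / c) powr (- (1 / 2)) = r powr (- (3 / 2)) / c powr (- (1 / 2))" if "r > 0" for r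
    proof -
      have "r ^ 3 = r powr 3" using that by simp
      thus ?thesis using that kern_c_pos by (simp only: powr_divide powr_powr) (simp add: powr_divide powr_powr)
    qed
    hence "?w powr (- (1 / 2)) = (z / v) powr (- (3 / 2)) / c powr (- (1 / 2))"
      using assms by simp
    also have "(z / v) powr (- (3 / 2)) = z powr (- (3 / 2)) * v powr (3 / 2)"
      using assms by (simp add: powr_divide powr_minus field_simps)
    finally show ?thesis using kern_c_pos by (simp add: powr_minus powr_half_sqrt field_simps)
  qed
  finally have e: "exp (- ?w) \<le> sqrt c * (z powr (- (3 / 2)) * v powr (3 / 2))" .
  have "kern t (z / v) v / v = K * (z / v ^ 2) * exp (- (v ^ 3 / c)) * exp (- ?w)"
    by (simp add: kern_eq power2_eq_square)
  also have "\<dots> \<le> K * (z / v ^ 2) * exp (- (v ^ 3 / c)) * (sqrt c * (z powr (- (3 / 2)) * v powr (3 / 2)))"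
    using assms kern_K_pos by (intro mult_left_mono e) auto
  also have "\<dots> = (z * z powr (- (3 / 2))) * (K * sqrt c * ((v powr (3 / 2) / v ^ 2) * exp (- (v ^ 3 / c))))"
    by simp
  also have "z * z powr (- (3 / 2)) = z powr (- (1 / 2))"
    using assms powr_add[of z 1 "- (3 / 2)"] by simp
  also have "v powr (3 / 2) / v ^ 2 = v powr (- (1 / 2))"
    using assms powr_diff[of v "3 / 2" 2] by simp
  finally show "kern t (z / v) v / v \<le> z powr (- (1 / 2)) * (K * sqrt c * (v powr (- (1 / 2)) * exp (- (v ^ 3 / c))))" .
qed

lemma set_integrable_kern_density_bound:
  "set_integrable lborel {0<..} (\<lambda>v. A * (K * sqrt c * (v powr (- (1 / 2)) * exp (- (v ^ 3 / c)))))"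
  by (intro set_integrable_mult_right set_integrable_powr_exp_cubic kern_c_pos) auto

lemma continuous_on_kern_fixed:
  assumes "z > 0" shows "continuous_on {0<..} (\<lambda>v. kern t (z / v) v / v)"
  unfolding kern_eq using kern_c_pos by (auto intro!: continuous_intros)

lemma set_integrable_kern_fixed:
  assumes "z > 0" shows "set_integrable lborel {0<..} (\<lambda>v. kern t (z / v) v / v)"
proof (rule set_integrable_bound[OF set_integrable_kern_density_bound[of "z powr (- (1 / 2))"]])
  show "set_borel_measurable lborel {0<..} (\<lambda>v. kern t (z / v) v / v)"
    using assms by (intro set_borel_measurable_lborel continuous_on_kern_fixed) auto
  have "norm (kern t (z / v) v / v) \<le> norm (z powr (- (1 / 2)) * (K * sqrt c * (v powr (- (1 / 2)) * exp (- (v ^ 3 / c)))))"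
    if "v > 0" for v
    unfolding real_norm_def abs_of_nonneg[OF kern_density_bound_aux(1)[OF assms that]]
    using kern_density_bound_aux(2)[OF assms that] by (rule order_trans[OF _ abs_ge_self])
  thus "AE v in lborel. v \<in> {0<..} \<longrightarrow> norm (kern t (z / v) v / v)
      \<le> norm (z powr (- (1 / 2)) * (K * sqrt c * (v powr (- (1 / 2)) * exp (- (v ^ 3 / c)))))"
    by (intro AE_I2) auto
qed

lemma kern_density_nonneg: "z > 0 \<Longrightarrow> kern_density t z \<ge> 0"
  unfolding kern_density_def set_lebesgue_integral_def
  by (intro Bochner_Integration.integral_nonneg) (auto simp: indicator_def kern_density_bound_aux)

lemma kern_density_bound:
  obtains C where "\<And>z. z > 0 \<Longrightarrow> kern_density t z \<le> C * z powr (- (1 / 2))"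
proof
  fix z :: real assume z: "z > 0"
  have "kern_density t z \<le> (LBINT v:{0<..}. z powr (- (1 / 2)) * (K * sqrt c * (v powr (- (1 / 2)) * exp (- (v ^ 3 / c)))))"
    unfolding kern_density_def using z
    by (intro set_integral_mono set_integrable_kern_fixed set_integrable_kern_density_bound)
       (auto intro!: kern_density_bound_aux)
  also have "\<dots> = (LBINT v:{0<..}. K * sqrt c * (v powr (- (1 / 2)) * exp (- (v ^ 3 / c)))) * z powr (- (1 / 2))"
    by (subst set_integral_mult_right) (rule mult.commute)
  finally show "kern_density t z \<le> (LBINT v:{0<..}. K * sqrt c * (v powr (- (1 / 2)) * exp (- (v ^ 3 / c)))) * z powr (- (1 / 2))" .
qed

text \<open>The majorant blows up as z tends to 0, so continuity at \<open>z\<close> is obtained on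
  the half-line beyond z/2, where the bound is uniform.\<close>

lemma continuous_on_kern_density: "continuous_on {0<..} (kern_density t)"
proof (intro continuous_at_imp_continuous_on ballI)
  fix z :: real assume "z \<in> {0<..}"
  hence z: "z > 0" by simp
  have "continuous_on {z/2<..} (kern_density t)"
    unfolding kern_density_def
  proof (rule continuous_on_LBINT_pos[OF _ _ _ set_integrable_kern_density_bound])
    fix x v :: real assume x: "x \<in> {z/2<..}" and v: "v > 0"
    have "kern t (x / v) v / v \<le> x powr (- (1 / 2)) * (K * sqrt c * (v powr (- (1 / 2)) * exp (- (v ^ 3 / c))))"
      using x z v by (intro kern_density_bound_aux) auto
    also have "\<dots> \<le> (z / 2) powr (- (1 / 2)) * (K * sqrt c * (v powr (- (1 / 2)) * exp (- (v ^ 3 / c))))"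
      using x z kern_K_pos kern_c_pos by (intro mult_right_mono powr_mono2') auto
    finally show "norm (kern t (x / v) v / v) \<le> (z / 2) powr (- (1 / 2)) * (K * sqrt c * (v powr (- (1 / 2)) * exp (- (v ^ 3 / c))))"
      using kern_density_bound_aux(1)[of x v] x z v by simp
  next
    show "continuous_on {0<..} (\<lambda>v. kern t (x / v) v / v)" if "x \<in> {z/2<..}" for x
      using that z by (intro continuous_on_kern_fixed) auto
    show "continuous_on {z/2<..} (\<lambda>x. kern t (x / v) v / v)" if "v > 0" for v
      unfolding kern_eq using kern_c_pos that by (auto intro!: continuous_intros)
  qed
  thus "isCont (kern_density t) z"
    using z by (simp add: continuous_on_eq_continuous_at)
qed

text \<open>Rescaling the inner integral by \<open>v\<close> and exchanging the order collects the
  kernel into its density. Against the majorant z^(-q) the double integral factors, and q < 1 is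
  integrability of v^(-q) at 0. The values are vectors because \<open>f\<close> will be both a real
  solution and a complex power.\<close>

lemma integral_kern_product:
  fixes f :: "real \<Rightarrow> 'b::euclidean_space" and q :: real
  assumes f: "continuous_on {0<..} f" and bound: "\<And>z. z > 0 \<Longrightarrow> norm (f z) \<le> C * z powr (- q)" and q: "q < 1"
  shows "set_integrable lborel {0<..} (\<lambda>z. kern_density t z *\<^sub>R f z)"
    and "(LBINT v:{0<..}. LBINT s:{0<..}. kern t s v *\<^sub>R f (s * v)) = (LBINT z:{0<..}. kern_density t z *\<^sub>R f z)"
proof -
  let ?F = "\<lambda>v z. (kern t (z / v) v / v) *\<^sub>R f z"
  let ?g = "\<lambda>v z. C * ((kern t (z / v) v / v) * z powr (- q))"
  have scaled: "(1 / v) *\<^sub>R (kern t ((1 / v) * z) v *\<^sub>R h ((1 / v) * z * v)) = (kern t (z / v) v / v) *\<^sub>R h z"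
    if "v > 0" for v z :: real and h :: "real \<Rightarrow> 'c::real_vector"
    using that by simp
  have cont: "continuous_on ({0<..} \<times> {0<..}) (\<lambda>(v, z). ?F v z)"
    unfolding kern_eq split_def using kern_c_pos
    by (auto intro!: continuous_intros continuous_on_compose2[OF f])
  have bd: "norm (?F v z) \<le> ?g v z" if "v > 0" "z > 0" for v z
  proof -
    note nonneg = kern_density_bound_aux(1)[OF that(2,1)]
    have "norm (?F v z) = (kern t (z / v) v / v) * norm (f z)"
      by (simp only: norm_scaleR abs_of_nonneg[OF nonneg])
    also have "\<dots> \<le> (kern t (z / v) v / v) * (C * z powr (- q))"
      by (intro mult_left_mono bound nonneg that)
    finally show ?thesis by (simp only: mult_ac)
  qed
  define J where "J = (LBINT s:{0<..}. s powr (1 - q) * exp (- (s ^ 3 / c)))"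
  \<comment> \<open>The factor \<open>s\<close> of the kernel raises the exponent of
    \<open>s\<close> to 1 - q, so the variables separate with different powers.\<close>
  have ks: "kern t s v * (s * v) powr (- q) = (K * (v powr (- q) * exp (- (v ^ 3 / c)))) * (s powr (1 - q) * exp (- (s ^ 3 / c)))"
    if "s > 0" "v > 0" for s v
  proof -
    have "s powr (1 - q) = s * s powr (- q)" using that by (simp add: powr_diff powr_minus divide_inverse)
    moreover have "(s * v) powr (- q) = s powr (- q) * v powr (- q)" using that by (simp add: powr_mult)
    ultimately show ?thesis by (simp only: kern_eq mult_ac)
  qed
  have int_ks: "set_integrable lborel {0<..} (\<lambda>s. kern t s v *\<^sub>R (s * v) powr (- q))" if v: "v > 0" for v
  proof -
    have "set_integrable lborel {0<..} (\<lambda>s. (K * (v powr (- q) * exp (- (v ^ 3 / c)))) * (s powr (1 - q) * exp (- (s ^ 3 / c))))"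
      using q kern_c_pos by (intro set_integrable_mult_right set_integrable_powr_exp_cubic) auto
    thus ?thesis by (rule set_integrable_transfer) (use v in \<open>simp add: ks\<close>)
  qed
  have cks: "continuous_on {0<..} (\<lambda>s. kern t s v *\<^sub>R (s * v) powr (- q))" if "v > 0" for v
    unfolding kern_eq using that kern_c_pos by (auto intro!: continuous_intros)
  have int_g: "set_integrable lborel {0<..} (?g v)" if v: "v > 0" for v
  proof -
    have "set_integrable lborel {0<..} (\<lambda>z. (1 / v) *\<^sub>R (kern t ((1 / v) * z) v *\<^sub>R ((1 / v) * z * v) powr (- q)))"
      using lborel_scale_pos(1)[OF cks[OF v], of "1 / v"] int_ks[OF v] v by simp
    thus ?thesis unfolding scaled[OF v, of _ "\<lambda>z. z powr (- q)"] unfolding real_scaleR_def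
      by (rule set_integrable_mult_right)
  qed
  have val_g: "(LBINT z:{0<..}. ?g v z) = (C * K * J) * (v powr (- q) * exp (- (v ^ 3 / c)))" if v: "v > 0" for v
  proof -
    have "(LBINT z:{0<..}. ?g v z) = C * (LBINT z:{0<..}. (1 / v) *\<^sub>R (kern t ((1 / v) * z) v *\<^sub>R ((1 / v) * z * v) powr (- q)))"
      unfolding scaled[OF v, of _ "\<lambda>z. z powr (- q)"] unfolding real_scaleR_def
      by (rule set_integral_mult_right)
    also have "\<dots> = C * (LBINT s:{0<..}. kern t s v *\<^sub>R (s * v) powr (- q))"
      using lborel_scale_pos(2)[OF cks[OF v], of "1 / v"] v by simp
    also have "(LBINT s:{0<..}. kern t s v *\<^sub>R (s * v) powr (- q))
        = (LBINT s:{0<..}. (K * (v powr (- q) * exp (- (v ^ 3 / c)))) * (s powr (1 - q) * exp (- (s ^ 3 / c))))"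
      using v by (intro set_lebesgue_integral_cong) (auto simp: ks)
    also have "\<dots> = (K * (v powr (- q) * exp (- (v ^ 3 / c)))) * J"
      unfolding J_def by (rule set_integral_mult_right)
    finally show ?thesis by (simp only: mult_ac)
  qed
  have int_int_g: "set_integrable lborel {0<..} (\<lambda>v. LBINT z:{0<..}. ?g v z)"
  proof -
    have "set_integrable lborel {0<..} (\<lambda>v. (C * K * J) * (v powr (- q) * exp (- (v ^ 3 / c))))"
      using q kern_c_pos by (intro set_integrable_mult_right set_integrable_powr_exp_cubic) auto
    thus ?thesis by (rule set_integrable_transfer) (simp only: val_g greaterThan_iff)
  qed
  note fubini = set_Fubini_pos[OF cont bd int_g int_int_g]
  have inner: "(LBINT v:{0<..}. ?F v z) = kern_density t z *\<^sub>R f z" if "z > 0" for z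
  proof -
    have "integrable lborel (\<lambda>v. indicator {0<..} v *\<^sub>R (kern t (z / v) v / v))"
      using set_integrable_kern_fixed[OF that] by (simp only: set_integrable_def)
    hence "(LBINT v. (indicator {0<..} v *\<^sub>R (kern t (z / v) v / v)) *\<^sub>R f z)
        = (LBINT v. indicator {0<..} v *\<^sub>R (kern t (z / v) v / v)) *\<^sub>R f z"
      by (intro integral_scaleR_left)
    thus ?thesis by (simp add: set_lebesgue_integral_def kern_density_def)
  qed
  have "set_integrable lborel {0<..} (\<lambda>z. LBINT v:{0<..}. ?F v z)" by (rule fubini(2))
  thus "set_integrable lborel {0<..} (\<lambda>z. kern_density t z *\<^sub>R f z)"
    by (rule set_integrable_transfer) (rule inner, simp)
  have outer: "(LBINT s:{0<..}. kern t s v *\<^sub>R f (s * v)) = (LBINT z:{0<..}. ?F v z)" if v: "v > 0" for v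
  proof -
    have "continuous_on {0<..} (\<lambda>s. kern t s v *\<^sub>R f (s * v))"
      unfolding kern_eq using v kern_c_pos by (auto intro!: continuous_intros continuous_on_compose2[OF f])
    from lborel_scale_pos(2)[OF this, of "1 / v"] show ?thesis
      using v unfolding scaled[OF v] by simp
  qed
  have "(LBINT v:{0<..}. LBINT s:{0<..}. kern t s v *\<^sub>R f (s * v)) = (LBINT v:{0<..}. LBINT z:{0<..}. ?F v z)"
    by (rule set_lebesgue_integral_cong, simp, intro allI impI, rule outer, simp)
  also have "\<dots> = (LBINT z:{0<..}. LBINT v:{0<..}. ?F v z)" by (rule fubini(1))
  also have "\<dots> = (LBINT z:{0<..}. kern_density t z *\<^sub>R f z)"
    by (rule set_lebesgue_integral_cong, simp, intro allI impI, rule inner, simp)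
  finally show "(LBINT v:{0<..}. LBINT s:{0<..}. kern t s v *\<^sub>R f (s * v)) = (LBINT z:{0<..}. kern_density t z *\<^sub>R f z)" .
qed

text \<open>Since the kernel and (s v)^(-q) both factor, the moment is a product of two cubic Gamma
  integrals.\<close>

lemma mellin_kern_density:
  assumes q: "Re q < 1"
  shows "set_integrable lborel {0<..} (\<lambda>z. of_real (kern_density t z) * of_real z powr (- q))"
    and "(LBINT z:{0<..}. of_real (kern_density t z) * of_real z powr (- q))
           = of_real t powr (- q / 3) * Gamma (1 - q) * rGamma (1 - q / 3)"
proof -
  define f where "f = (\<lambda>z. complex_of_real z powr (- q))"
  have cont: "continuous_on {0<..} f" unfolding f_def by (auto intro!: continuous_intros)
  have bound: "norm (f z) \<le> 1 * z powr (- Re q)" if "z > 0" for z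
    using that by (simp add: f_def norm_powr_real_powr)
  note kp = integral_kern_product[OF cont bound q]
  show "set_integrable lborel {0<..} (\<lambda>z. of_real (kern_density t z) * of_real z powr (- q))"
    using kp(1) by (simp add: f_def scaleR_conv_of_real)
  let ?I = "\<lambda>w. LBINT s:{0<..}. of_real s powr (3 * w - 1) * complex_of_real (exp (- (s ^ 3 / c)))"
  let ?G = "\<lambda>w s. of_real s powr (3 * w - 1) * complex_of_real (exp (- (s ^ 3 / c)))"
  \<comment> \<open>The exponents of \<open>v\<close> and \<open>s\<close> are - q = 3 w1 - 1 and 1
    - q = 3 w2 - 1.\<close>
  define w1 where "w1 = (1 - q) / 3"
  define w2 where "w2 = (2 - q) / 3"
  have w: "Re w1 > 0" "Re w2 > 0" using q by (simp_all add: w1_def w2_def)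
  have eq: "kern t s v *\<^sub>R f (s * v) = (of_real K * ?G w1 v) * ?G w2 s" if "s > 0" "v > 0" for s v
  proof -
    have s: "complex_of_real s powr (3 * w2 - 1) = of_real s * of_real s powr (- q)"
    proof -
      have "3 * w2 - 1 = 1 + (- q)" by (simp add: w2_def)
      thus ?thesis using that by (simp only: powr_add) simp
    qed
    have v: "complex_of_real v powr (3 * w1 - 1) = of_real v powr (- q)"
    proof -
      have "3 * w1 - 1 = - q" by (simp add: w1_def field_simps)
      thus ?thesis by (simp only:)
    qed
    have "complex_of_real (s * v) powr (- q) = of_real s powr (- q) * of_real v powr (- q)"
      using that powr_times_of_real_left[of s "of_real v" "- q"] by simp
    thus ?thesis unfolding f_def kern_eq s v by (simp add: scaleR_conv_of_real)
  qed
  have "(LBINT z:{0<..}. of_real (kern_density t z) * of_real z powr (- q))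
      = (LBINT v:{0<..}. LBINT s:{0<..}. kern t s v *\<^sub>R f (s * v))"
  proof -
    have "(\<lambda>z. of_real (kern_density t z) * of_real z powr (- q)) = (\<lambda>z. kern_density t z *\<^sub>R f z)"
      by (simp add: f_def scaleR_conv_of_real)
    thus ?thesis by (simp only: kp(2))
  qed
  also have "\<dots> = (LBINT v:{0<..}. of_real K * ?I w2 * ?G w1 v)"
  proof (intro set_lebesgue_integral_cong allI impI)
    fix v :: real assume v: "v \<in> {0<..}"
    have "(LBINT s:{0<..}. kern t s v *\<^sub>R f (s * v)) = (LBINT s:{0<..}. (of_real K * ?G w1 v) * ?G w2 s)"
      using v by (intro set_lebesgue_integral_cong allI impI) (simp, simp only: eq greaterThan_iff)
    also have "\<dots> = (of_real K * ?G w1 v) * ?I w2" by (rule set_integral_mult_right)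
    finally show "(LBINT s:{0<..}. kern t s v *\<^sub>R f (s * v)) = of_real K * ?I w2 * ?G w1 v"
      by (simp only: mult_ac)
  qed simp
  also have "\<dots> = of_real K * ?I w2 * ?I w1" by (rule set_integral_mult_right)
  also have "\<dots> = of_real K * (of_real c powr w2 * Gamma w2 / 3) * (of_real c powr w1 * Gamma w1 / 3)"
    unfolding Gamma_integral_cubic(2)[OF w(1) kern_c_pos] Gamma_integral_cubic(2)[OF w(2) kern_c_pos] ..
  also have "\<dots> = (of_real (K / 9) * (of_real c powr w2 * of_real c powr w1)) * (Gamma w1 * Gamma w2)"
    by (simp add: mult_ac)
  \<comment> \<open>The points w1, w2 and 1 - q/3 are w1, w1 + 1/3 and w1 + 2/3. The third factor of
    the triplication formula is absent from the product and therefore ends up as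
    \<open>rGamma\<close>.\<close>
  also have "Gamma w1 * Gamma w2 = of_real (2 * pi * sqrt 3) * exp (- (1 - q) * of_real (ln 3)) * Gamma (1 - q) * rGamma (1 - q / 3)"
  proof -
    have w2': "w1 + 1 / 3 = w2" and w3': "w1 + 2 / 3 = 1 - q / 3" and w1': "3 * w1 = 1 - q"
      "- 3 * w1 = - (1 - q)"
      by (simp_all add: w1_def w2_def field_simps)
    have "Gamma (1 - q / 3) * rGamma (1 - q / 3) = 1"
      using q by (intro Gamma_mult_rGamma) simp
    hence "Gamma w1 * Gamma w2 = Gamma w1 * Gamma (w1 + 1 / 3) * Gamma (w1 + 2 / 3) * rGamma (1 - q / 3)"
      unfolding w2' w3' by (simp add: mult.assoc)
    thus ?thesis unfolding Gamma_triplication_complex w1' .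
  qed
  finally have "(LBINT z:{0<..}. of_real (kern_density t z) * of_real z powr (- q)) =
      (of_real (K / 9 * (2 * pi * sqrt 3)) * (of_real c powr w2 * of_real c powr w1) * exp (- (1 - q) * of_real (ln 3))) *
      Gamma (1 - q) * rGamma (1 - q / 3)" by simp
  \<comment> \<open>Here the normalisation of the kernel pays off: in the exponents all multiples of
    ln 3 cancel, and only - q/3 times ln t survives.\<close>
  also have "of_real (K / 9 * (2 * pi * sqrt 3)) * (of_real c powr w2 * of_real c powr w1) * exp (- (1 - q) * of_real (ln 3))
      = complex_of_real t powr (- q / 3)"
  proof -
    have lc: "ln c = 3 / 2 * ln 3 + 1 / 2 * ln t"
      using t by (simp add: c_def ln_mult ln_sqrt field_simps)
    have "K / 9 * (2 * pi * sqrt 3) = exp (- (ln 3 + ln t) / 2)"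
    proof -
      have "K / 9 * (2 * pi * sqrt 3) = sqrt 3 / (3 * sqrt t)" by (simp add: K_def)
      also have "\<dots> = 1 / (sqrt 3 * sqrt t)" using t by (simp add: field_simps)
      also have "\<dots> = exp (- (ln (sqrt 3) + ln (sqrt t)))"
      proof -
        have "exp (ln (sqrt 3) + ln (sqrt t)) = sqrt 3 * sqrt t" using t by (simp add: exp_add)
        thus ?thesis unfolding exp_minus by (simp only: divide_inverse mult_1)
      qed
      finally show ?thesis using t by (simp add: ln_sqrt field_simps)
    qed
    hence k: "complex_of_real (K / 9 * (2 * pi * sqrt 3)) = exp (- (of_real (ln 3) + of_real (ln t)) / 2)"
      by (simp only: exp_of_real [symmetric]) simp
    have cp: "complex_of_real c powr x = exp (x * (3 / 2 * of_real (ln 3) + 1 / 2 * of_real (ln t)))" for x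
      using kern_c_pos by (simp add: powr_def Ln_of_real lc)
    have tp: "complex_of_real t powr x = exp (x * of_real (ln t))" for x
      using t by (simp add: powr_def Ln_of_real)
    show ?thesis
      unfolding k cp tp exp_add [symmetric] by (rule arg_cong[of _ _ exp]) (simp add: w1_def w2_def field_simps)
  qed
  finally show "(LBINT z:{0<..}. of_real (kern_density t z) * of_real z powr (- q))
           = of_real t powr (- q / 3) * Gamma (1 - q) * rGamma (1 - q / 3)" .
qed

end

section \<open>Subordination\<close>

text \<open>The solution of order 2 b in the variable y = |x| / lam, up to the factor 1 / (2 lam).
  For fixed \<open>y\<close> it is integrated in \<open>z\<close>, for fixed \<open>z\<close> it is
  Mellin transformed in \<open>y\<close>.\<close>

definition mwright_kernel :: "real \<Rightarrow> real \<Rightarrow> real \<Rightarrow> real" where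
  "mwright_kernel b y z = z powr (- b) * mwright b (y * z powr (- b))"

lemma u_sol_eq_mwright_kernel:
  assumes "lam > 0" "z > 0"
  shows "u_sol lam mu x z = mwright_kernel (mu / 2) (\<bar>x\<bar> / lam) z / (2 * lam)"
proof -
  have "- \<bar>x\<bar> / (lam * z powr (mu / 2)) = - (\<bar>x\<bar> / lam * z powr (- (mu / 2)))"
    by (simp add: powr_minus field_simps)
  moreover have "- mu * real k / 2 + 1 - mu / 2 = 1 - mu / 2 * (real k + 1)" for k
    by (simp add: field_simps)
  moreover have "1 / (2 * lam * z powr (mu / 2)) = z powr (- (mu / 2)) / (2 * lam)"
    by (simp add: powr_minus field_simps)
  ultimately show ?thesis
    by (simp only: u_sol_def mwright_kernel_def mwright_def) simp
qed

lemma mwright_0: "mwright b 0 = rGamma (1 - b)"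
proof -
  have "mwright b 0 = (\<Sum>k. (inverse (fact k) * rGamma (1 - b * (real k + 1))) * 0 ^ k)"
    unfolding mwright_def by (intro arg_cong[of _ _ suminf] ext) (simp add: field_simps)
  thus ?thesis by (simp only: powser_zero) simp
qed

lemma continuous_on_mwright_kernel:
  assumes "0 < b" "b < 1" "y > 0"
  shows "continuous_on {0<..} (mwright_kernel b y)"
  unfolding mwright_kernel_def using assms
  by (auto intro!: continuous_intros continuous_on_compose2[OF continuous_on_mwright])

lemma continuous_on_mwright_kernel':
  assumes "0 < b" "b < 1" "z > 0"
  shows "continuous_on {0<..} (\<lambda>y. mwright_kernel b y z)"
  unfolding mwright_kernel_def using assms
  by (auto intro!: continuous_intros continuous_on_compose2[OF continuous_on_mwright])

text \<open>A larger \<beta> gives more decay in \<open>y\<close> together with a milder singularity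
  in \<open>z\<close>, though the bound gets worse as y tends to 0; \<beta> = 0 gives a bound
  uniform in \<open>y\<close>.\<close>

lemma mwright_kernel_bound:
  assumes b: "0 < b" "b < 1" and \<beta>: "0 \<le> \<beta>" "\<beta> < 1"
  obtains C where "C \<ge> 0"
    "\<And>y z. y > 0 \<Longrightarrow> z > 0 \<Longrightarrow> \<bar>mwright_kernel b y z\<bar> \<le> C * y powr (- \<beta>) * z powr (- (b * (1 - \<beta>)))"
proof -
  obtain C where C: "C \<ge> 0" "\<And>u. u > 0 \<Longrightarrow> \<bar>mwright b u\<bar> \<le> C * u powr (- \<beta>)"
    using mwright_bound[OF b \<beta>] by blast
  have "\<bar>mwright_kernel b y z\<bar> \<le> C * y powr (- \<beta>) * z powr (- (b * (1 - \<beta>)))" if "y > 0" "z > 0" for y z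
  proof -
    have "\<bar>mwright_kernel b y z\<bar> \<le> z powr (- b) * (C * (y * z powr (- b)) powr (- \<beta>))"
      unfolding mwright_kernel_def abs_mult using that C(2)[of "y * z powr (- b)"] by (simp add: mult_left_mono)
    also have "(y * z powr (- b)) powr (- \<beta>) = y powr (- \<beta>) * z powr (b * \<beta>)"
      using that by (simp add: powr_mult powr_powr)
    also have "z powr (- b) * (C * (y powr (- \<beta>) * z powr (b * \<beta>))) = C * y powr (- \<beta>) * (z powr (- b) * z powr (b * \<beta>))"
      by simp
    also have "z powr (- b) * z powr (b * \<beta>) = z powr (- (b * (1 - \<beta>)))"
      by (simp add: algebra_simps flip: powr_add)
    finally show ?thesis .
  qed
  thus ?thesis using C(1) that by blast
qed

text \<open>Self-similarity turns the dependence on \<open>z\<close> into a power. The integral of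
  the norm scales in the same way, which supplies the majorant for exchanging the integrals over
  \<open>y\<close> and \<open>z\<close>.\<close>

lemma mellin_mwright_kernel:
  assumes b: "0 < b" "b < 1" and z: "z > 0" and \<sigma>: "0 < Re \<sigma>" "Re \<sigma> < 1"
  defines "f \<equiv> \<lambda>z y. of_real y powr (\<sigma> - 1) * complex_of_real (mwright_kernel b y z)"
  shows "set_integrable lborel {0<..} (f z)"
    and "(LBINT y:{0<..}. f z y)
      = Gamma \<sigma> * rGamma (1 - of_real b * (1 - \<sigma>)) * of_real z powr (- (of_real b * (1 - \<sigma>)))"
    and "(LBINT y:{0<..}. norm (f z y)) = z powr (- (b * (1 - Re \<sigma>))) * (LBINT y:{0<..}. norm (f 1 y))"
proof -
  define F where "F = (\<lambda>u. of_real u powr (\<sigma> - 1) * complex_of_real (mwright b u))"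
  define c where "c = z powr (- b)"
  have c: "c > 0" using z by (simp add: c_def)
  have f1: "f 1 = F" by (simp add: f_def F_def mwright_kernel_def)
  have cF: "continuous_on {0<..} F"
    unfolding F_def by (auto intro!: continuous_intros continuous_on_mwright b)
  have cnF: "continuous_on {0<..} (\<lambda>u. norm (F u))" using cF by (rule continuous_on_norm)
  have intF: "set_integrable lborel {0<..} F" unfolding F_def by (rule mellin_mwright(1)[OF b \<sigma>])
  define k where "k = of_real z powr (- (of_real b * (1 - \<sigma>)))"
  have nk: "norm k = z powr (- (b * (1 - Re \<sigma>)))" using z by (simp add: k_def norm_powr_real_powr)
  have k: "k * of_real c powr (\<sigma> - 1) = 1"
  proof -
    have "Ln (complex_of_real c) = - of_real b * of_real (ln z)"
      using z c by (subst Ln_of_real) (simp_all add: c_def ln_powr)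
    thus ?thesis using z c by (simp add: k_def powr_def Ln_of_real algebra_simps flip: exp_add)
  qed
  have eq: "f z y = k * (c *\<^sub>R F (c * y))" if "y > 0" for y
  proof -
    have "F (c * y) = of_real c powr (\<sigma> - 1) * of_real y powr (\<sigma> - 1) * of_real (mwright b (c * y))"
      using that powr_times_of_real_left[OF c, of "of_real y" "\<sigma> - 1"] by (simp add: F_def)
    hence "k * (c *\<^sub>R F (c * y)) = (k * of_real c powr (\<sigma> - 1)) * (of_real y powr (\<sigma> - 1) * of_real (c * mwright b (c * y)))"
      by (simp add: scaleR_conv_of_real)
    thus ?thesis unfolding k by (simp add: f_def mwright_kernel_def c_def mult.commute)
  qed
  have neq: "norm (f z y) = norm k * (c *\<^sub>R norm (F (c * y)))" if "y > 0" for y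
    unfolding eq[OF that] using c by (simp add: norm_mult)
  have "set_integrable lborel {0<..} (\<lambda>y. k * (c *\<^sub>R F (c * y)))"
    by (intro set_integrable_mult_right lborel_scale_pos(1)[OF cF c, THEN iffD2] intF)
  thus "set_integrable lborel {0<..} (f z)"
    by (rule set_integrable_transfer) (simp add: eq)
  have "(LBINT y:{0<..}. f z y) = (LBINT y:{0<..}. k * (c *\<^sub>R F (c * y)))"
    by (rule set_lebesgue_integral_cong) (auto simp: eq)
  also have "\<dots> = k * (LBINT u:{0<..}. F u)"
    unfolding set_integral_mult_right lborel_scale_pos(2)[OF cF c] ..
  also have "(LBINT u:{0<..}. F u) = Gamma \<sigma> * rGamma (1 - of_real b * (1 - \<sigma>))"
    unfolding F_def by (rule mellin_mwright(2)[OF b \<sigma>])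
  finally show "(LBINT y:{0<..}. f z y)
      = Gamma \<sigma> * rGamma (1 - of_real b * (1 - \<sigma>)) * of_real z powr (- (of_real b * (1 - \<sigma>)))"
    by (simp add: k_def mult_ac)
  have "(LBINT y:{0<..}. norm (f z y)) = (LBINT y:{0<..}. norm k * (c *\<^sub>R norm (F (c * y))))"
    by (rule set_lebesgue_integral_cong) (auto simp: neq)
  also have "\<dots> = norm k * (LBINT u:{0<..}. norm (F u))"
    unfolding set_integral_mult_right lborel_scale_pos(2)[OF cnF c] ..
  finally show "(LBINT y:{0<..}. norm (f z y)) = z powr (- (b * (1 - Re \<sigma>))) * (LBINT y:{0<..}. norm (f 1 y))"
    unfolding nk f1 .
qed

lemma set_integrable_kern_density_powr:
  assumes "t > 0" "p < 1"
  shows "set_integrable lborel {0<..} (\<lambda>z. kern_density t z * z powr (- p))"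
proof -
  have "continuous_on {0<..} (\<lambda>z::real. z powr (- p))" by (auto intro!: continuous_intros)
  from integral_kern_product(1)[OF assms(1) this _ assms(2), of 1] show ?thesis by simp
qed

text \<open>The difference \<open>D\<close> of the two sides, as a function of \<open>y\<close>,
  satisfies the hypotheses of the uniqueness theorem. Its transform is computed by exchanging the
  integral over \<open>y\<close> with the one against the density.\<close>

theorem mwright_kernel_subordination:
  assumes b: "0 < b" "b < 1" and t: "t > 0" and y: "y > 0"
  shows "mwright_kernel (b / 3) y t = (LBINT z:{0<..}. kern_density t z * mwright_kernel b y z)"
proof -
  define R where "R = (\<lambda>y. LBINT z:{0<..}. kern_density t z * mwright_kernel b y z)"
  define D where "D = (\<lambda>y. mwright_kernel (b / 3) y t - R y)"
  have a: "0 < b / 3" "b / 3 < 1" using b by auto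
  have cz: "continuous_on {0<..} (\<lambda>z. kern_density t z * mwright_kernel b y z)" if "y > 0" for y
    by (intro continuous_on_mult continuous_on_kern_density continuous_on_mwright_kernel t b that)
  have kbound: "norm (kern_density t z * mwright_kernel b y z) \<le> A * (kern_density t z * z powr (- p))"
    if "z > 0" "\<bar>mwright_kernel b y z\<bar> \<le> A * z powr (- p)" for y z A p
  proof -
    have "norm (kern_density t z * mwright_kernel b y z) = kern_density t z * \<bar>mwright_kernel b y z\<bar>"
      using kern_density_nonneg[OF t that(1)] by (simp add: abs_mult)
    also have "\<dots> \<le> kern_density t z * (A * z powr (- p))"
      by (intro mult_left_mono that kern_density_nonneg t)
    finally show ?thesis by (simp only: mult_ac)
  qed
  \<comment> \<open>\<beta> = 0: a majorant in \<open>z\<close> independent of \<open>y\<close>,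
    giving integrability and continuity of \<open>R\<close>.\<close>
  obtain C0 where C0: "C0 \<ge> 0" "\<And>y z. y > 0 \<Longrightarrow> z > 0 \<Longrightarrow> \<bar>mwright_kernel b y z\<bar> \<le> C0 * y powr (- 0) * z powr (- (b * (1 - 0)))"
    using mwright_kernel_bound[OF b, of 0] by auto
  have b0: "norm (kern_density t z * mwright_kernel b y z) \<le> C0 * (kern_density t z * z powr (- b))"
    if "y > 0" "z > 0" for y z
    using C0(2)[OF that] that by (intro kbound) auto
  have intz: "set_integrable lborel {0<..} (\<lambda>z. kern_density t z * mwright_kernel b y z)" if "y > 0" for y
  proof (rule set_integrable_bound)
    show "set_integrable lborel {0<..} (\<lambda>z. C0 * (kern_density t z * z powr (- b)))"
      by (intro set_integrable_mult_right set_integrable_kern_density_powr t b)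
    show "set_borel_measurable lborel {0<..} (\<lambda>z. kern_density t z * mwright_kernel b y z)"
      by (intro set_borel_measurable_lborel cz that) auto
    show "AE z in lborel. z \<in> {0<..} \<longrightarrow> norm (kern_density t z * mwright_kernel b y z)
        \<le> norm (C0 * (kern_density t z * z powr (- b)))"
      using b0[OF that] by (intro AE_I2) (auto intro: order_trans[OF _ abs_ge_self])
  qed
  have contR: "continuous_on {0<..} R"
    unfolding R_def
  proof (rule continuous_on_LBINT_pos)
    show "set_integrable lborel {0<..} (\<lambda>z. C0 * (kern_density t z * z powr (- b)))"
      by (intro set_integrable_mult_right set_integrable_kern_density_powr t b)
    show "continuous_on {0<..} (\<lambda>y. kern_density t z * mwright_kernel b y z)" if "z > 0" for z
      by (intro continuous_on_mult continuous_on_const continuous_on_mwright_kernel' b that)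
  qed (use cz b0 in auto)
  have cont: "continuous_on {0<..} D"
    unfolding D_def by (intro continuous_on_diff contR continuous_on_mwright_kernel' a t)
  \<comment> \<open>\<beta> = 1/2: the decay in \<open>y\<close> demanded by the uniqueness theorem,
    for both sides.\<close>
  obtain C1 where C1: "C1 \<ge> 0" "\<And>y z. y > 0 \<Longrightarrow> z > 0 \<Longrightarrow>
      \<bar>mwright_kernel (b / 3) y z\<bar> \<le> C1 * y powr (- (1 / 2)) * z powr (- (b / 3 * (1 - 1 / 2)))"
    using mwright_kernel_bound[OF a, of "1 / 2"] by auto
  obtain C2 where C2: "C2 \<ge> 0" "\<And>y z. y > 0 \<Longrightarrow> z > 0 \<Longrightarrow>
      \<bar>mwright_kernel b y z\<bar> \<le> C2 * y powr (- (1 / 2)) * z powr (- (b * (1 - 1 / 2)))"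
    using mwright_kernel_bound[OF b, of "1 / 2"] by auto
  have p: "b * (1 - 1 / 2) < 1" using b by simp
  let ?I = "LBINT z:{0<..}. kern_density t z * z powr (- (b * (1 - 1 / 2)))"
  have bound: "\<bar>D y\<bar> \<le> (C1 * t powr (- (b / 3 * (1 - 1 / 2))) + C2 * ?I) * y powr (- (1 / 2))" if y: "y > 0" for y
  proof -
    have "\<bar>R y\<bar> \<le> (LBINT z:{0<..}. norm (kern_density t z * mwright_kernel b y z))"
      unfolding R_def using set_integral_norm_bound[OF intz[OF y]] by simp
    also have "\<dots> \<le> (LBINT z:{0<..}. (C2 * y powr (- (1 / 2))) * (kern_density t z * z powr (- (b * (1 - 1 / 2)))))"
      by (intro set_integral_mono set_integrable_norm intz y set_integrable_mult_right
          set_integrable_kern_density_powr t p kbound C2(2)) auto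
    also have "\<dots> = (C2 * y powr (- (1 / 2))) * ?I" by (rule set_integral_mult_right)
    finally have "\<bar>R y\<bar> \<le> (C2 * y powr (- (1 / 2))) * ?I" .
    moreover have "\<bar>D y\<bar> \<le> \<bar>mwright_kernel (b / 3) y t\<bar> + \<bar>R y\<bar>"
      unfolding D_def by (rule abs_triangle_ineq4)
    ultimately have "\<bar>D y\<bar> \<le> C1 * y powr (- (1 / 2)) * t powr (- (b / 3 * (1 - 1 / 2))) + (C2 * y powr (- (1 / 2))) * ?I"
      using C1(2)[OF y t] by linarith
    thus ?thesis by (simp only: distrib_left distrib_right mult_ac)
  qed
  have mellin: "set_integrable lborel {0<..} (\<lambda>y. of_real y powr (\<sigma> - 1) * complex_of_real (D y)) \<and>
      (LBINT y:{0<..}. of_real y powr (\<sigma> - 1) * complex_of_real (D y)) = 0" if \<sigma>: "Re \<sigma> = 1 / 2" for \<sigma>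
  proof -
    have \<sigma>': "0 < Re \<sigma>" "Re \<sigma> < 1" using \<sigma> by auto
    define f where "f = (\<lambda>z y. of_real y powr (\<sigma> - 1) * complex_of_real (mwright_kernel b y z))"
    define q where "q = of_real b * (1 - \<sigma>)"
    define M where "M = (LBINT y:{0<..}. norm (f 1 y))"
    have mk: "set_integrable lborel {0<..} (f z)"
      "(LBINT y:{0<..}. f z y) = Gamma \<sigma> * rGamma (1 - q) * of_real z powr (- q)"
      "(LBINT y:{0<..}. norm (f z y)) = z powr (- (b * (1 - Re \<sigma>))) * M"
      if "z > 0" for z
      unfolding M_def f_def q_def using mellin_mwright_kernel[OF b that \<sigma>'] by simp_all
    have b\<sigma>: "b * (1 - Re \<sigma>) < 1" unfolding \<sigma> using b by simp
    hence Req: "Re q < 1" by (simp add: q_def)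
    have fub_cont: "continuous_on ({0<..} \<times> {0<..}) (\<lambda>(z, y). of_real (kern_density t z) * f z y)"
      unfolding f_def mwright_kernel_def split_def
      by (auto intro!: continuous_intros continuous_on_compose2[OF continuous_on_mwright[OF b]]
          continuous_on_compose2[OF continuous_on_kern_density[OF t]])
    have fub_bound: "norm (of_real (kern_density t z) * f z y) \<le> kern_density t z * norm (f z y)" if "z > 0" "y > 0" for z y
      using kern_density_nonneg[OF t that(1)] by (simp add: norm_mult)
    have fub_int: "set_integrable lborel {0<..} (\<lambda>y. kern_density t z * norm (f z y))" if "z > 0" for z
      by (intro set_integrable_mult_right set_integrable_norm mk(1) that)
    have fub_int_int: "set_integrable lborel {0<..} (\<lambda>z. LBINT y:{0<..}. kern_density t z * norm (f z y))"
    proof -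
      have "set_integrable lborel {0<..} (\<lambda>z. M * (kern_density t z * z powr (- (b * (1 - Re \<sigma>)))))"
        by (intro set_integrable_mult_right set_integrable_kern_density_powr t b\<sigma>)
      thus ?thesis
        by (rule set_integrable_transfer) (simp only: set_integral_mult_right mk(3) greaterThan_iff mult_ac)
    qed
    note fub = set_Fubini_pos[OF fub_cont fub_bound fub_int fub_int_int]
    have inner: "(LBINT z:{0<..}. of_real (kern_density t z) * f z y) = of_real y powr (\<sigma> - 1) * of_real (R y)" for y
    proof -
      have "(LBINT z:{0<..}. of_real (kern_density t z) * f z y)
          = (LBINT z:{0<..}. of_real y powr (\<sigma> - 1) * of_real (kern_density t z * mwright_kernel b y z))"
        by (simp add: f_def mult_ac)
      thus ?thesis unfolding set_integral_mult_right set_integral_complex_of_real R_def .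
    qed
    have int2: "set_integrable lborel {0<..} (\<lambda>y. of_real y powr (\<sigma> - 1) * complex_of_real (R y))"
    proof -
      have "set_integrable lborel {0<..} (\<lambda>y. LBINT z:{0<..}. of_real (kern_density t z) * f z y)"
        by (rule fub(2))
      thus ?thesis unfolding inner .
    qed
    have val2: "(LBINT y:{0<..}. of_real y powr (\<sigma> - 1) * complex_of_real (R y))
        = Gamma \<sigma> * rGamma (1 - q / 3) * of_real t powr (- (q / 3))"
    proof -
      have "(LBINT y:{0<..}. of_real y powr (\<sigma> - 1) * complex_of_real (R y))
          = (LBINT y:{0<..}. LBINT z:{0<..}. of_real (kern_density t z) * f z y)"
        unfolding inner ..
      also have "\<dots> = (LBINT z:{0<..}. LBINT y:{0<..}. of_real (kern_density t z) * f z y)"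
        by (rule fub(1) [symmetric])
      also have "\<dots> = (LBINT z:{0<..}. (Gamma \<sigma> * rGamma (1 - q)) * (of_real (kern_density t z) * of_real z powr (- q)))"
        by (rule set_lebesgue_integral_cong, simp, intro allI impI)
           (simp only: set_integral_mult_right mk(2) greaterThan_iff, simp only: mult_ac)
      also have "\<dots> = (Gamma \<sigma> * rGamma (1 - q)) * (of_real t powr (- q / 3) * Gamma (1 - q) * rGamma (1 - q / 3))"
        unfolding set_integral_mult_right mellin_kern_density(2)[OF t Req] ..
      also have "\<dots> = Gamma \<sigma> * (Gamma (1 - q) * rGamma (1 - q)) * rGamma (1 - q / 3) * of_real t powr (- (q / 3))"
        by (simp add: mult_ac)
      \<comment> \<open>The profile of order \<open>b\<close> brings 1/Gamma (1 - q), the moment of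
        the density brings Gamma (1 - q). What remains, 1/Gamma (1 - q/3), belongs to the order
        b/3.\<close>
      also have "Gamma (1 - q) * rGamma (1 - q) = 1" using Req by (intro Gamma_mult_rGamma) simp
      finally show ?thesis by simp
    qed
    note mk1 = mellin_mwright_kernel[OF a t \<sigma>']
    have q3: "of_real (b / 3) * (1 - \<sigma>) = q / 3" by (simp add: q_def)
    have eq: "of_real y powr (\<sigma> - 1) * complex_of_real (D y) =
        of_real y powr (\<sigma> - 1) * complex_of_real (mwright_kernel (b / 3) y t) -
        of_real y powr (\<sigma> - 1) * complex_of_real (R y)" for y
      by (simp add: D_def right_diff_distrib)
    show ?thesis
      unfolding eq using set_integral_diff[OF mk1(1) int2] mk1(2) val2 unfolding q3 by simp
  qed
  have "D y = 0"
    by (rule mellin_eq_0_imp_eq_0[OF cont bound _ _ y]) (use mellin in auto)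
  thus ?thesis by (simp add: D_def R_def)
qed

text \<open>At y = 0 the profile is the constant 1/Gamma (1 - b), so the claim reduces to the moment
  of the density with q = b.\<close>

theorem mwright_kernel_subordination_0:
  assumes b: "0 < b" "b < 1" and t: "t > 0"
  shows "mwright_kernel (b / 3) 0 t = (LBINT z:{0<..}. kern_density t z * mwright_kernel b 0 z)"
proof -
  have "complex_of_real (LBINT z:{0<..}. kern_density t z * z powr (- b))
      = (LBINT z:{0<..}. of_real (kern_density t z) * of_real z powr (- of_real b))"
    unfolding set_integral_complex_of_real [symmetric]
    by (rule set_lebesgue_integral_cong) (auto simp: powr_of_real [symmetric])
  also have "\<dots> = of_real t powr (- of_real b / 3) * Gamma (1 - of_real b) * rGamma (1 - of_real b / 3)"
    using b by (intro mellin_kern_density(2) t) simp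
  also have "\<dots> = of_real (t powr (- b / 3) * Gamma (1 - b) * rGamma (1 - b / 3))"
    using t by (simp add: powr_of_real [symmetric] Gamma_complex_of_real [symmetric] rGamma_complex_of_real [symmetric])
  finally have I: "(LBINT z:{0<..}. kern_density t z * z powr (- b)) = t powr (- b / 3) * Gamma (1 - b) * rGamma (1 - b / 3)"
    by (simp only: of_real_eq_iff)
  have "(LBINT z:{0<..}. kern_density t z * mwright_kernel b 0 z)
      = rGamma (1 - b) * (LBINT z:{0<..}. kern_density t z * z powr (- b))"
  proof -
    have "(\<lambda>z. kern_density t z * mwright_kernel b 0 z) = (\<lambda>z. rGamma (1 - b) * (kern_density t z * z powr (- b)))"
      by (simp add: mwright_kernel_def mwright_0 mult_ac)
    thus ?thesis by (simp only: set_integral_mult_right)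
  qed
  also have "\<dots> = (Gamma (1 - b) * rGamma (1 - b)) * (t powr (- (b / 3)) * rGamma (1 - b / 3))"
    unfolding I by (simp add: mult_ac)
  also have "Gamma (1 - b) * rGamma (1 - b) = 1"
  proof -
    have "Gamma (1 - b) > 0" using b by (intro Gamma_real_pos) simp
    thus ?thesis by (simp add: rGamma_inverse_Gamma)
  qed
  finally show ?thesis by (simp add: mwright_kernel_def mwright_0)
qed

text \<open>With q = 1 - \<sigma> the moment formula is t^(-(1 - \<sigma>)/3) Gamma \<sigma> / Gamma
  (1 - (1 - \<sigma>)/3), which is the Mellin transform of the profile of order 1/3 at time
  \<open>t\<close>.\<close>

theorem kern_density_eq_mwright_kernel:
  assumes t: "t > 0" and z: "z > 0"
  shows "kern_density t z = mwright_kernel (1 / 3) z t"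
proof -
  define D where "D = (\<lambda>z. kern_density t z - mwright_kernel (1 / 3) z t)"
  have a: "0 < (1 / 3 :: real)" "1 / 3 < (1::real)" by auto
  have cont: "continuous_on {0<..} D"
    unfolding D_def by (intro continuous_on_diff continuous_on_kern_density continuous_on_mwright_kernel' a t)
  obtain C1 where C1: "C1 \<ge> 0" "\<And>y z. y > 0 \<Longrightarrow> z > 0 \<Longrightarrow>
      \<bar>mwright_kernel (1 / 3) y z\<bar> \<le> C1 * y powr (- (1 / 2)) * z powr (- (1 / 3 * (1 - 1 / 2)))"
    using mwright_kernel_bound[OF a, of "1 / 2"] by auto
  obtain C2 where C2: "\<And>z. z > 0 \<Longrightarrow> kern_density t z \<le> C2 * z powr (- (1 / 2))"
    using kern_density_bound[OF t] by blast
  have bound: "\<bar>D y\<bar> \<le> (C2 + C1 * t powr (- (1 / 3 * (1 - 1 / 2)))) * y powr (- (1 / 2))" if y: "y > 0" for y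
  proof -
    have "\<bar>D y\<bar> \<le> \<bar>kern_density t y\<bar> + \<bar>mwright_kernel (1 / 3) y t\<bar>"
      unfolding D_def by (rule abs_triangle_ineq4)
    also have "\<dots> \<le> C2 * y powr (- (1 / 2)) + C1 * y powr (- (1 / 2)) * t powr (- (1 / 3 * (1 - 1 / 2)))"
      using C2[OF y] kern_density_nonneg[OF t y] by (intro add_mono C1(2) y t) simp
    finally show ?thesis by (simp only: distrib_left distrib_right mult_ac)
  qed
  have mellin: "set_integrable lborel {0<..} (\<lambda>y. of_real y powr (\<sigma> - 1) * complex_of_real (D y)) \<and>
      (LBINT y:{0<..}. of_real y powr (\<sigma> - 1) * complex_of_real (D y)) = 0" if \<sigma>: "Re \<sigma> = 1 / 2" for \<sigma>
  proof -
    have \<sigma>': "0 < Re \<sigma>" "Re \<sigma> < 1" using \<sigma> by auto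
    note mk1 = mellin_mwright_kernel[OF a t \<sigma>']
    have q: "Re (1 - \<sigma>) < 1" using \<sigma> by simp
    note kd = mellin_kern_density[OF t q]
    have eq: "of_real y powr (\<sigma> - 1) * complex_of_real (D y) =
        of_real (kern_density t y) * of_real y powr (- (1 - \<sigma>)) -
        of_real y powr (\<sigma> - 1) * complex_of_real (mwright_kernel (1 / 3) y t)" for y
      by (simp add: D_def right_diff_distrib mult.commute)
    have e: "(\<sigma> - 1) / 3 = - ((1 - \<sigma>) / 3)" by (simp add: field_simps)
    show ?thesis
      unfolding eq using set_integral_diff[OF kd(1) mk1(1)] kd(2) mk1(2) by (simp add: mult_ac e)
  qed
  have "D z = 0"
    by (rule mellin_eq_0_imp_eq_0[OF cont bound _ _ z]) (use mellin in auto)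
  thus ?thesis by (simp add: D_def)
qed

section \<open>From the half-line to the real line, and the conclusion\<close>

lemma integral_lborel_split_pos_neg:
  fixes G :: "real \<Rightarrow> real"
  assumes p: "set_integrable lborel {0<..} G" and n: "set_integrable lborel {0<..} (\<lambda>x. G (- x))"
  shows "(LBINT x. G x) = (LBINT x:{0<..}. G x + G (- x))"
proof -
  let ?P = "\<lambda>x. indicator {0<..} x *\<^sub>R G x" and ?N = "\<lambda>x. indicator {0<..} x *\<^sub>R G (- x)"
  have iP: "integrable lborel ?P" and iN: "integrable lborel ?N"
    using p n by (simp_all add: set_integrable_def)
  have iN': "integrable lborel (\<lambda>x. ?N (- x))"
    using lborel_integrable_real_affine[OF iN, of "- 1" 0] by simp
  have "AE x in lborel. G x = ?P x + ?N (- x)"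
    using AE_lborel_singleton[of 0] by eventually_elim (auto simp: indicator_def)
  moreover have "G \<in> borel_measurable lborel"
  proof -
    \<comment> \<open>Measurability of \<open>G\<close> comes from its integrable halves together
      with its value at the single point 0.\<close>
    have "(\<lambda>x. (?P x + ?N (- x)) + indicator {0} x * G 0) \<in> borel_measurable lborel"
      by (intro borel_measurable_add borel_measurable_times borel_measurable_indicator borel_measurable_const
          borel_measurable_integrable[OF iP] borel_measurable_integrable[OF iN']) simp
    also have "(\<lambda>x. (?P x + ?N (- x)) + indicator {0} x * G 0) = G"
      by (auto simp: fun_eq_iff indicator_def)
    finally show ?thesis .
  qed
  ultimately have "(LBINT x. G x) = (LBINT x. ?P x + ?N (- x))"
    by (intro integral_cong_AE borel_measurable_add borel_measurable_integrable[OF iP] borel_measurable_integrable[OF iN'])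
  also have "\<dots> = (LBINT x. ?P x) + (LBINT x. ?N (- x))"
    by (rule Bochner_Integration.integral_add[OF iP iN'])
  also have "(LBINT x. ?N (- x)) = (LBINT x. ?N x)"
    using lborel_integral_real_affine[of "- 1" ?N 0] by simp
  also have "(LBINT x. ?P x) + (LBINT x. ?N x) = (LBINT x:{0<..}. G x + G (- x))"
    unfolding set_integral_add(2)[OF p n] by (simp add: set_lebesgue_integral_def)
  finally show ?thesis .
qed

lemma bounded_of_compact_support:
  fixes \<phi> :: "real \<Rightarrow> real"
  assumes "continuous_on UNIV \<phi>" "bounded {y. \<phi> y \<noteq> 0}"
  obtains C where "\<And>y. \<bar>\<phi> y\<bar> \<le> C"
proof -
  obtain r where r: "\<And>y. \<phi> y \<noteq> 0 \<Longrightarrow> \<bar>y\<bar> \<le> r"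
    using assms(2) by (auto simp: bounded_iff)
  have "compact (\<phi> ` cball 0 r)"
    using assms(1) by (intro compact_continuous_image continuous_on_subset[OF assms(1)]) auto
  then obtain C where C: "\<And>y. y \<in> cball 0 r \<Longrightarrow> \<bar>\<phi> y\<bar> \<le> C"
    using compact_imp_bounded by (fastforce simp: bounded_iff)
  have "\<bar>\<phi> y\<bar> \<le> max C 0" for y
    using C[of y] r[of y] by (cases "\<phi> y = 0") (auto simp: dist_real_def)
  thus ?thesis by (rule that)
qed

theorem theorem5p1:
  fixes lam nu t :: real
  assumes "lam > 0" and "0 < nu" and "nu \<le> 2 / 3" and "t > 0"
  shows "(nu < 2 / 3 \<longrightarrow>
            (\<forall>x. u_sol lam nu x t =
                 (LBINT v:{0<..}. LBINT s:{0<..}. kern t s v * u_sol lam (3 * nu) x (s * v))))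
       \<and> (nu = 2 / 3 \<longrightarrow>
            (\<forall>\<phi> :: real \<Rightarrow> real. continuous_on UNIV \<phi> \<and> bounded {y. \<phi> y \<noteq> 0} \<longrightarrow>
               (LBINT x. u_sol lam nu x t * \<phi> x) =
               (LBINT v:{0<..}. LBINT s:{0<..}.
                   kern t s v * ((\<phi> (lam * s * v) + \<phi> (- lam * s * v)) / 2))))"
proof (intro conjI impI allI)
  fix x :: real
  assume nu: "nu < 2 / 3"
  define b where "b = 3 * nu / 2"
  define y where "y = \<bar>x\<bar> / lam"
  have b: "0 < b" "b < 1" using assms nu by (simp_all add: b_def)
  have y: "y \<ge> 0" using assms by (simp add: y_def)
  \<comment> \<open>Continuity of \<open>mwright b\<close> is available on the open half-line only;
    at y = 0 the kernel is a constant times a power of \<open>z\<close>.\<close>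
  have cont: "continuous_on {0<..} (mwright_kernel b y)"
  proof (cases "y = 0")
    case True
    thus ?thesis unfolding mwright_kernel_def by (auto intro!: continuous_intros)
  qed (use y b in \<open>auto intro!: continuous_on_mwright_kernel\<close>)
  have "\<exists>C. \<forall>z>0. norm (mwright_kernel b y z) \<le> C * z powr (- b)"
  proof (cases "y = 0")
    case True
    thus ?thesis by (intro exI[of _ "\<bar>mwright b 0\<bar>"]) (simp add: mwright_kernel_def abs_mult mult.commute)
  next
    case False
    with y have y0: "y > 0" by simp
    obtain C where "C \<ge> 0" "\<And>y z. y > 0 \<Longrightarrow> z > 0 \<Longrightarrow> \<bar>mwright_kernel b y z\<bar> \<le> C * y powr (- 0) * z powr (- (b * (1 - 0)))"
      using mwright_kernel_bound[OF b, of 0] by auto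
    thus ?thesis using y0 by (intro exI[of _ C]) fastforce
  qed
  then obtain C where C: "\<And>z. z > 0 \<Longrightarrow> norm (mwright_kernel b y z) \<le> C * z powr (- b)" by blast
  have "(LBINT v:{0<..}. LBINT s:{0<..}. kern t s v * u_sol lam (3 * nu) x (s * v))
      = (LBINT v:{0<..}. LBINT s:{0<..}. (kern t s v *\<^sub>R mwright_kernel b y (s * v)) / (2 * lam))"
    using assms by (intro set_lebesgue_integral_cong allI impI)
      (simp_all add: u_sol_eq_mwright_kernel b_def y_def)
  also have "\<dots> = (LBINT v:{0<..}. LBINT s:{0<..}. kern t s v *\<^sub>R mwright_kernel b y (s * v)) / (2 * lam)"
    by simp
  also have "\<dots> = (LBINT z:{0<..}. kern_density t z *\<^sub>R mwright_kernel b y z) / (2 * lam)"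
    by (simp only: integral_kern_product(2)[OF \<open>t > 0\<close> cont C b(2)])
  also have "(LBINT z:{0<..}. kern_density t z *\<^sub>R mwright_kernel b y z) = mwright_kernel (b / 3) y t"
    using mwright_kernel_subordination[OF b \<open>t > 0\<close>] mwright_kernel_subordination_0[OF b \<open>t > 0\<close>] y
    by (cases "y = 0") auto
  also have "\<dots> / (2 * lam) = u_sol lam nu x t"
    using assms by (simp add: u_sol_eq_mwright_kernel b_def y_def)
  finally show "u_sol lam nu x t = (LBINT v:{0<..}. LBINT s:{0<..}. kern t s v * u_sol lam (3 * nu) x (s * v))" ..
next
  fix \<phi> :: "real \<Rightarrow> real"
  assume nu: "nu = 2 / 3" and \<phi>: "continuous_on UNIV \<phi> \<and> bounded {y. \<phi> y \<noteq> 0}"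
  note lam = \<open>lam > 0\<close> and t = \<open>t > 0\<close>
  obtain C where C: "\<And>y. \<bar>\<phi> y\<bar> \<le> C" using bounded_of_compact_support \<phi> by blast
  define f where "f = (\<lambda>z. (\<phi> (lam * z) + \<phi> (- lam * z)) / 2)"
  have c\<phi>: "continuous_on A (\<lambda>z. \<phi> (k * z))" for A k
    using \<phi> by (auto intro!: continuous_on_compose2[of UNIV \<phi>] continuous_intros)
  \<comment> \<open>Bounded functions enter \<open>integral_kern_product\<close> with the exponent q
    = 0.\<close>
  have bd: "norm (\<phi> (k * z)) \<le> C * z powr (- 0)" if "z > 0" for z k using C that by simp
  have int: "set_integrable lborel {0<..} (\<lambda>z. kern_density t z * \<phi> (k * z))" for k
    using integral_kern_product(1)[OF t c\<phi> bd, of k] by simp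
  have cf: "continuous_on {0<..} f" unfolding f_def by (intro continuous_intros c\<phi>) auto
  have bf: "norm (f z) \<le> C * z powr (- 0)" if "z > 0" for z
    using C[of "lam * z"] C[of "- lam * z"] that unfolding f_def by simp
  have "(LBINT v:{0<..}. LBINT s:{0<..}. kern t s v * ((\<phi> (lam * s * v) + \<phi> (- lam * s * v)) / 2))
      = (LBINT z:{0<..}. kern_density t z * f z)"
    using integral_kern_product(2)[OF t cf bf] by (simp add: f_def mult.assoc)
  \<comment> \<open>Now mu/2 = 1/3, so \<open>u_sol\<close> at x is the density at |x| / lam divided
    by 2 lam. Folding the line at 0 and substituting x = lam z turns the test function into the mean
    \<open>f\<close> of its values at lam z and - lam z.\<close>
  moreover have "(LBINT x. u_sol lam nu x t * \<phi> x) = (LBINT z:{0<..}. kern_density t z * f z)"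
  proof -
    define G where "G = (\<lambda>x. u_sol lam nu x t * \<phi> x)"
    \<comment> \<open>The sign k = 1 or k = -1 treats both half-lines at once.\<close>
    have G: "G (k * x) = kern_density t (x / lam) * \<phi> (k * lam * (x / lam)) / (2 * lam)"
      if "x > 0" "\<bar>k\<bar> = 1" for x k
      using that lam t kern_density_eq_mwright_kernel[OF t, of "x / lam"]
      by (simp add: G_def u_sol_eq_mwright_kernel nu abs_mult)
    have ck: "continuous_on {0<..} (\<lambda>z. kern_density t z * \<phi> (k * lam * z) / 2)" for k
      by (intro continuous_intros continuous_on_kern_density t c\<phi>) auto
    have intG: "set_integrable lborel {0<..} (\<lambda>x. G (k * x))" if "\<bar>k\<bar> = 1" for k
    proof -
      have "set_integrable lborel {0<..} (\<lambda>x. (1 / lam) *\<^sub>R (kern_density t (1 / lam * x) * \<phi> (k * lam * (1 / lam * x)) / 2))"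
        using int[of "k * lam"] lam by (intro lborel_scale_pos(1)[OF ck, THEN iffD2]) auto
      thus ?thesis
        by (rule set_integrable_transfer) (use G[OF _ that] lam in simp)
    qed
    have "(LBINT x. G x) = (LBINT x:{0<..}. G x + G (- x))"
      using integral_lborel_split_pos_neg[of G] intG[of 1] intG[of "- 1"] by simp
    also have "\<dots> = (LBINT x:{0<..}. (1 / lam) *\<^sub>R (kern_density t (1 / lam * x) * f (1 / lam * x)))"
    proof (rule set_lebesgue_integral_cong, simp, intro allI impI)
      fix x :: real assume "x \<in> {0<..}"
      thus "G x + G (- x) = (1 / lam) *\<^sub>R (kern_density t (1 / lam * x) * f (1 / lam * x))"
        using G[of x 1] G[of x "- 1"] lam by (simp add: f_def field_simps)
    qed
    also have "\<dots> = (LBINT z:{0<..}. kern_density t z * f z)"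
      using lam by (intro lborel_scale_pos(2) continuous_on_mult continuous_on_kern_density cf t) auto
    finally show ?thesis by (simp add: G_def)
  qed
  ultimately show "(LBINT x. u_sol lam nu x t * \<phi> x) =
      (LBINT v:{0<..}. LBINT s:{0<..}. kern t s v * ((\<phi> (lam * s * v) + \<phi> (- lam * s * v)) / 2))"
    by simp
qed

end
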